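(* For any $\ell\in\frac12\mathbb{N}$ the monic matrix-valued orthogonal polynomials $R_n$ on $[0,1]$ defined in the context satisfy, for all $n\ge0$ (with $R_{-1}=0$), the three-term recurrence relation $$u\,R_n(u)=R_{n+1}(u)+X_n\,R_n(u)+Y_n\,R_{n-1}(u),$$ where $$X_n=-\sum_{i=0}^{2\ell}\left[\frac{i^2E_{i,i-1}}{4(n+i)(n+i+1)}-\frac{E_{i,i}}{2}+\frac{(2\ell-i)^2E_{i,i+1}}{4(2\ell+n-i)(2\ell+n-i+1)}\right],$$ $$Y_n=\sum_{i=0}^{2\ell}\frac{n^2(2\ell+n+1)^2}{16(n+i)(n+i+1)(2\ell+n-i)(2\ell+n-i+1)}E_{i,i}.$$
   Context: $\mathbb{N}=\{0,1,2,\dots\}$; matrices are $(2\ell+1)\times(2\ell+1)$, indexed by $0,\dots,2\ell$; $E_{ij}$ are the matrix units, with the convention that $E_{ij}$ (and any term containing it) is zero if $i$ or $j$ is out of range; for $n=0$ the term $Y_0R_{-1}$ is zero. $(a)_k$ is the Pochhammer symbol and $U_r$ the Chebyshev polynomial of the second kind. For $0\le m\le n\le2\ell$, $x\in[-1,1]$, $$W(x)_{n,m}=\sqrt{1-x^2}\sum_{t=0}^m\alpha_t(m,n)U_{n+m-2t}(x),\quad \alpha_t(m,n)=\frac{2\ell+1}{n+1}\frac{(2\ell-m)!\,m!}{(2\ell)!}(-1)^{m-t}\frac{(n-2\ell)_{m-t}}{(n+2)_{m-t}}\frac{(2\ell+2-t)_t}{t!},$$ and $W(x)_{n,m}=W(x)_{m,n}$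 for $n<m$. $P_n$ is the unique monic (leading coefficient $I$) $M_{2\ell+1}(\mathbb{C})$-valued polynomial of degree $n$ with $\int_{-1}^1P_n(x)W(x)P_m(x)^*dx=0$ for $n\ne m$, and $R_n(u)=(-1)^n2^{-n}P_n(1-2u)$; thus the $R_n$ are the monic orthogonal polynomials for the weight $Z(u)=W(1-2u)$ on $[0,1]$. *)

theory Defs
  imports
    "HOL-Analysis.Analysis"
    "Jordan_Normal_Form.Schur_Decomposition"
begin

text \<open>
  Throughout, \<open>N\<close> stands for \<open>2\<ell>\<close>, so that \<open>\<ell>\<close> ranging over the half-integers
  \<open>0, 1/2, 1, \<dots>\<close> corresponds to \<open>N\<close> ranging over all natural numbers. Matrices have size
  \<open>N + 1\<close> and are indexed by \<open>0, \<dots>, N\<close>.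
\<close>

fun cheb_U :: "nat \<Rightarrow> real \<Rightarrow> real" where
  "cheb_U 0 x = 1"
| "cheb_U (Suc 0) x = 2 * x"
| "cheb_U (Suc (Suc n)) x = 2 * x * cheb_U (Suc n) x - cheb_U n x"

text \<open>
  Only used for \<open>t \<le> m \<le> n \<le> N\<close>, so that the subtractions on type \<^typ>\<open>nat\<close> are exact;
  those that may be negative are taken in \<^typ>\<open>real\<close>.
\<close>
definition weight_coeff :: "nat \<Rightarrow> nat \<Rightarrow> nat \<Rightarrow> nat \<Rightarrow> real" where
  "weight_coeff N t m n =
     (real N + 1) / (real n + 1) * (fact (N - m) * fact m / fact N) * (- 1) ^ (m - t)
     * (pochhammer (real n - real N) (m - t) / pochhammer (real n + 2) (m - t))
     * (pochhammer (real N + 2 - real t) t / fact t)"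

text \<open>The entry \<open>W(x)\<^bsub>n,m\<^esub>\<close> for \<open>m \<le> n\<close>.\<close>
definition weight_entry :: "nat \<Rightarrow> nat \<Rightarrow> nat \<Rightarrow> real \<Rightarrow> real" where
  "weight_entry N n m x =
     sqrt (1 - x\<^sup>2) * (\<Sum>t\<le>m. weight_coeff N t m n * cheb_U (n + m - 2 * t) x)"

definition weight :: "nat \<Rightarrow> real \<Rightarrow> complex mat" where
  "weight N x = mat (N + 1) (N + 1) (\<lambda>(n, m).
     complex_of_real (if m \<le> n then weight_entry N n m x else weight_entry N m n x))"

text \<open>
  A matrix-valued polynomial is a matrix of polynomials; its \<open>k\<close>-th coefficient and its value
  at a point are taken entrywise.
\<close>
definition mpoly_coeff :: "complex poly mat \<Rightarrow> nat \<Rightarrow> complex mat" where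
  "mpoly_coeff P k = map_mat (\<lambda>p. coeff p k) P"

definition mpoly_eval :: "complex poly mat \<Rightarrow> complex \<Rightarrow> complex mat" where
  "mpoly_eval P z = map_mat (\<lambda>p. poly p z) P"

definition monic_mpoly :: "nat \<Rightarrow> nat \<Rightarrow> complex poly mat \<Rightarrow> bool" where
  "monic_mpoly N n P \<longleftrightarrow>
     P \<in> carrier_mat (N + 1) (N + 1) \<and>
     mpoly_coeff P n = 1\<^sub>m (N + 1) \<and>
     (\<forall>k>n. mpoly_coeff P k = 0\<^sub>m (N + 1) (N + 1))"

definition mat_integral :: "nat \<Rightarrow> real \<Rightarrow> real \<Rightarrow> (real \<Rightarrow> complex mat) \<Rightarrow> complex mat" where
  "mat_integral N a b F =
     mat (N + 1) (N + 1) (\<lambda>(i, j). integral {a..b} (\<lambda>x. F x $$ (i, j)))"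

definition weight_pairing :: "nat \<Rightarrow> complex poly mat \<Rightarrow> complex poly mat \<Rightarrow> complex mat" where
  "weight_pairing N P Q = mat_integral N (- 1) 1
     (\<lambda>x. mpoly_eval P (of_real x) * weight N x * mat_adjoint (mpoly_eval Q (of_real x)))"

text \<open>The sequence \<open>P\<^sub>0, P\<^sub>1, \<dots>\<close> of monic orthogonal polynomials for the weight \<open>W\<close>.\<close>
definition monic_orthogonal_mpolys :: "nat \<Rightarrow> (nat \<Rightarrow> complex poly mat) \<Rightarrow> bool" where
  "monic_orthogonal_mpolys N P \<longleftrightarrow>
     (\<forall>n. monic_mpoly N n (P n)) \<and>
     (\<forall>n m. n \<noteq> m \<longrightarrow> weight_pairing N (P n) (P m) = 0\<^sub>m (N + 1) (N + 1))"

text \<open>The value \<open>R\<^sub>n(u) = (-1)\<^sup>n 2\<^sup>-\<^sup>n P\<^sub>n(1 - 2u)\<close>.\<close>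
definition shifted_mpoly :: "(nat \<Rightarrow> complex poly mat) \<Rightarrow> nat \<Rightarrow> complex \<Rightarrow> complex mat" where
  "shifted_mpoly P n u = ((- 1) ^ n / 2 ^ n) \<cdot>\<^sub>m mpoly_eval (P n) (1 - 2 * u)"

text \<open>
  The entry at position \<open>(r, s)\<close> of the matrix unit \<open>E\<^bsub>ij\<^esub>\<close>. The indices \<open>i\<close> and \<open>j\<close> are
  integers, so that for instance \<open>E\<^bsub>0,-1\<^esub>\<close> is the zero matrix.
\<close>
definition mat_unit :: "int \<Rightarrow> int \<Rightarrow> nat \<Rightarrow> nat \<Rightarrow> complex" where
  "mat_unit i j r s = (if int r = i \<and> int s = j then 1 else 0)"

text \<open>
  The denominators below can only vanish for \<open>n = 0\<close> and \<open>i = 0\<close> or \<open>i = N\<close>. In \<open>X\<^sub>0\<close> the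
  matrix unit is then out of range, and \<open>Y\<^sub>0\<close> is only multiplied by zero.
\<close>
definition X_mat :: "nat \<Rightarrow> nat \<Rightarrow> complex mat" where
  "X_mat N n = - mat (N + 1) (N + 1) (\<lambda>(r, s). \<Sum>i = 0..N.
     of_nat i ^ 2 / (4 * (of_nat n + of_nat i) * (of_nat n + of_nat i + 1))
         * mat_unit (int i) (int i - 1) r s
     - mat_unit (int i) (int i) r s / 2
     + (of_nat N - of_nat i) ^ 2
         / (4 * (of_nat N + of_nat n - of_nat i) * (of_nat N + of_nat n - of_nat i + 1))
         * mat_unit (int i) (int i + 1) r s)"

definition Y_mat :: "nat \<Rightarrow> nat \<Rightarrow> complex mat" where
  "Y_mat N n = mat (N + 1) (N + 1) (\<lambda>(r, s). \<Sum>i = 0..N.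
     of_nat n ^ 2 * (of_nat N + of_nat n + 1) ^ 2
       / (16 * (of_nat n + of_nat i) * (of_nat n + of_nat i + 1)
          * (of_nat N + of_nat n - of_nat i) * (of_nat N + of_nat n - of_nat i + 1))
       * mat_unit (int i) (int i) r s)"

end

theory Submission
  imports Defs
begin

text \<open>
  The matrix polynomials that are orthogonal for \<open>W\<close> come from the spherical functions of
  \<open>SU(2) \<times> SU(2)\<close> with its diagonal subgroup. The label \<open>(n, i)\<close> stands for row \<open>i\<close> of the polynomial
  of degree \<open>n\<close>, and to it belong representations of dimensions \<open>\<alpha> = n + i + 1\<close> and
  \<open>\<beta> = n + N - i + 1\<close>. With a suitable diagonal normalisation the recurrence relation to be proved
  becomes
  \<open>2 \<alpha> \<beta> x \<Phi>\<^bsub>n,i\<^esub> = \<tau>\<^bsub>n+1\<^esub> \<Phi>\<^bsub>n+1,i\<^esub> + \<tau>\<^bsub>n\<^esub> \<Phi>\<^bsub>n-1,i\<^esub> + \<rho>\<^bsub>i+1\<^esub> \<Phi>\<^bsub>n,i+1\<^esub> + \<rho>\<^bsub>i\<^esub> \<Phi>\<^bsub>n,i-1\<^esub>\<close>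
  with \<open>\<tau>\<^bsub>n\<^esub> = n (n + N + 1)\<close> and \<open>\<rho>\<^bsub>i\<^esub> = i (N + 1 - i)\<close>. The proof starts from this relation: it
  defines the \<open>\<Phi>\<close> by it and shows that the resulting monic polynomials are orthogonal; as such
  polynomials are unique, they are the given ones.

  The four terms of the recurrence are grouped by whether they raise or lower \<open>\<alpha>\<close>. The two
  resulting operators and \<open>\<alpha>\<close> form an \<open>sl(2)\<close>-triple (\<open>raise_lower_commutator\<close>), and this algebra
  implies that the rows are eigenfunctions of a second-order differential operator with
  eigenvalue \<open>- \<alpha>\<^sup>2\<close> (\<open>spherical_second_order\<close>).

  The weight enters through its Fourier coefficients only. These have a closed form as a product of
  factorials, symmetric under exchange of the indices and under \<open>i \<mapsto> N - i\<close>, and satisfy a contiguous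
  relation (\<open>sine_coef_lower\<close>) which says that the differential operator is symmetric for the weight
  (\<open>column_moment_operator\<close>). So the integral of row \<open>(n, i)\<close> against the constant row \<open>b\<close> vanishes
  unless \<open>\<alpha> = b + 1\<close>, and by reflection unless \<open>\<beta> = N - b + 1\<close>, that is, unless \<open>n = 0\<close> and
  \<open>b = i\<close>. From this single case the recurrence gives the orthogonality of all rows and the
  nonvanishing of their norms (\<open>gram_upper\<close>, \<open>gram_diag\<close>), as in Favard's theorem. Uniqueness
  (\<open>monic_orthogonal_mpolys_unique\<close>) follows since the pairing is nondegenerate, and undoing the
  normalisation yields the stated coefficients.
\<close>

section \<open>The raising and lowering operators of the recurrence\<close>

text \<open>
  Moving the row label \<open>(n, i)\<close> vertically changes \<open>n\<close>, moving it horizontally changes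
  \<open>i\<close>. The step between \<open>n - 1\<close> and \<open>n\<close> carries the same numerator \<open>n (n + N + 1)\<close> in both
  directions, and the step between \<open>i - 1\<close> and \<open>i\<close> the numerator \<open>i (N + 1 - i)\<close>; the latter
  vanishes at \<open>i = 0\<close> and at \<open>i = N + 1\<close>, so that no step leaves the strip \<open>0 \<le> i \<le> N\<close>.
\<close>
definition vert_coef :: "nat \<Rightarrow> nat \<Rightarrow> real" where
  "vert_coef N n = real n * (real n + real N + 1)"

definition horiz_coef :: "nat \<Rightarrow> nat \<Rightarrow> real" where
  "horiz_coef N i = real i * (real N + 1 - real i)"

text \<open>
  The dimensions \<open>n + i + 1\<close> and \<open>n + N - i + 1\<close> of the two \<open>SU(2)\<close>-representations that
  belong to the label \<open>(n, i)\<close>. Every step of the lattice changes each of them by one.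
\<close>
abbreviation lidx :: "nat \<Rightarrow> nat \<Rightarrow> real" where
  "lidx n i \<equiv> real n + real i + 1"

abbreviation ridx :: "nat \<Rightarrow> nat \<Rightarrow> nat \<Rightarrow> real" where
  "ridx N n i \<equiv> real n + real N - real i + 1"

lemma vert_coef_0 [simp]: "vert_coef N 0 = 0"
  by (simp add: vert_coef_def)

lemma vert_coef_Suc_pos [simp]: "vert_coef N (Suc n) > 0"
  by (simp add: vert_coef_def add_pos_nonneg)

lemma horiz_coef_0 [simp]: "horiz_coef N 0 = 0"
  by (simp add: horiz_coef_def)

lemma horiz_coef_top [simp]: "horiz_coef N (Suc N) = 0"
  by (simp add: horiz_coef_def)

text \<open>
  The steps that increase the left dimension. The denominator is that of the right
  dimension only: the remaining factor \<open>lidx n i\<close> of the recurrence is kept outside, which is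
  what makes the commutator below a multiple of it. In the opposite operator the truncated
  predecessors of \<open>n = 0\<close> and \<open>i = 0\<close> are multiplied by zero.
\<close>
definition raise :: "nat \<Rightarrow> (nat \<Rightarrow> nat \<Rightarrow> real) \<Rightarrow> nat \<Rightarrow> nat \<Rightarrow> real" where
  "raise N f n i =
     (vert_coef N (Suc n) * f (Suc n) i + horiz_coef N (Suc i) * f n (Suc i)) / (2 * ridx N n i)"

definition lower :: "nat \<Rightarrow> (nat \<Rightarrow> nat \<Rightarrow> real) \<Rightarrow> nat \<Rightarrow> nat \<Rightarrow> real" where
  "lower N f n i =
     (vert_coef N n * f (n - 1) i + horiz_coef N i * f n (i - 1)) / (2 * ridx N n i)"

lemma raise_lidx:
  "raise N (\<lambda>n i. lidx n i * f n i) n i = (lidx n i + 1) * raise N f n i"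
  by (simp add: raise_def algebra_simps add_divide_distrib)

lemma lower_lidx:
  "lower N (\<lambda>n i. lidx n i * f n i) n i = (lidx n i - 1) * lower N f n i"
  by (cases n; cases i) (simp_all add: lower_def algebra_simps add_divide_distrib)

lemma vert_horiz_up:
  "vert_coef N (Suc n) + horiz_coef N i = lidx n i * (ridx N n i + 1)"
  by (simp add: vert_coef_def horiz_coef_def algebra_simps)

lemma vert_horiz_down:
  "horiz_coef N (Suc i) + vert_coef N n = lidx n i * (ridx N n i - 1)"
  by (simp add: vert_coef_def horiz_coef_def algebra_simps)

text \<open>
  Together with multiplication by \<open>lidx\<close> this is an \<open>sl(2)\<close>-triple. The two paths from \<open>(n, i)\<close> to
  \<open>(n + 1, i - 1)\<close> have equal weights, and so do those to \<open>(n - 1, i + 1)\<close>, so only the return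
  to \<open>(n, i)\<close> survives. There the differences of squares factor through the two preceding
  lemmas, which cancels the denominators of the intermediate labels.
\<close>
lemma raise_lower_commutator:
  assumes "i \<le> N"
  shows "raise N (lower N f) n i - lower N (raise N f) n i = lidx n i / 2 * f n i"
proof -
  let ?b = "ridx N n i"
  let ?v = "vert_coef N" and ?h = "horiz_coef N"
  have b: "?b > 0" using assms by simp
  have R: "raise N (lower N f) n i =
      (?v (Suc n) * ((?v (Suc n) * f n i + ?h i * f (Suc n) (i - 1)) / (2 * (?b + 1)))
       + ?h (Suc i) * ((?v n * f (n - 1) (Suc i) + ?h (Suc i) * f n i) / (2 * (?b - 1)))) / (2 * ?b)"
    by (simp add: raise_def lower_def algebra_simps)
  have v: "?v n * raise N f (n - 1) i =
      ?v n * ((?v n * f n i + ?h (Suc i) * f (n - 1) (Suc i)) / (2 * (?b - 1)))"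
    by (cases n) (simp_all add: raise_def algebra_simps)
  have h: "?h i * raise N f n (i - 1) =
      ?h i * ((?v (Suc n) * f (Suc n) (i - 1) + ?h i * f n i) / (2 * (?b + 1)))"
    by (cases i) (simp_all add: raise_def algebra_simps)
  have L: "lower N (raise N f) n i =
      (?v n * ((?v n * f n i + ?h (Suc i) * f (n - 1) (Suc i)) / (2 * (?b - 1)))
       + ?h i * ((?v (Suc n) * f (Suc n) (i - 1) + ?h i * f n i) / (2 * (?b + 1)))) / (2 * ?b)"
    unfolding lower_def[of N "raise N f"] v h ..
  \<comment> \<open>The factor of the return path through the larger right dimension.\<close>
  have up: "(?v (Suc n) * ?v (Suc n) - ?h i * ?h i) / (2 * (?b + 1)) =
      lidx n i * (?v (Suc n) - ?h i) / 2"
  proof -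
    have "?v (Suc n) * ?v (Suc n) - ?h i * ?h i = lidx n i * (?b + 1) * (?v (Suc n) - ?h i)"
      unfolding vert_horiz_up[symmetric] by (simp add: algebra_simps)
    then show ?thesis using b by (simp add: field_simps)
  qed
  have down: "(?h (Suc i) * ?h (Suc i) - ?v n * ?v n) / (2 * (?b - 1)) =
      lidx n i * (?h (Suc i) - ?v n) / 2"
  \<comment> \<open>Only \<open>n = 0\<close>, \<open>i = N\<close> makes the denominator vanish, and then both numerators are zero.\<close>
  proof (cases "?b = 1")
    case True
    then have "n = 0" "i = N" using assms by linarith+
    then show ?thesis by simp
  next
    case False
    have "?h (Suc i) * ?h (Suc i) - ?v n * ?v n = lidx n i * (?b - 1) * (?h (Suc i) - ?v n)"
      unfolding vert_horiz_down[symmetric] by (simp add: algebra_simps)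
    then show ?thesis using False by (simp add: divide_simps) (simp add: algebra_simps)
  qed
  have "raise N (lower N f) n i - lower N (raise N f) n i =
      ((?v (Suc n) * ?v (Suc n) - ?h i * ?h i) / (2 * (?b + 1))
       + (?h (Suc i) * ?h (Suc i) - ?v n * ?v n) / (2 * (?b - 1))) * f n i / (2 * ?b)"
    unfolding R L by (simp add: add_divide_distrib diff_divide_distrib algebra_simps)
  also have "\<dots> = lidx n i * (?v (Suc n) - ?h i + ?h (Suc i) - ?v n) / 2 * f n i / (2 * ?b)"
    unfolding up down by (simp add: add_divide_distrib diff_divide_distrib algebra_simps)
  also have "?v (Suc n) - ?h i + ?h (Suc i) - ?v n = 2 * ?b"
    by (simp add: vert_coef_def horiz_coef_def algebra_simps)
  also have "lidx n i * (2 * ?b) / 2 * f n i / (2 * ?b) = lidx n i / 2 * f n i"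
  proof -
    have "a * (2 * b) / 2 * c / (2 * b) = a / 2 * c" if "b > 0" for a b c :: real
      using that by simp
    then show ?thesis using b .
  qed
  finally show ?thesis .
qed

definition satisfies_recurrence :: "nat \<Rightarrow> real \<Rightarrow> (nat \<Rightarrow> nat \<Rightarrow> real) \<Rightarrow> bool" where
  "satisfies_recurrence N x f \<longleftrightarrow>
     (\<forall>n i. i \<le> N \<longrightarrow> raise N f n i + lower N f n i = lidx n i * x * f n i)"

text \<open>
  The recurrence expresses row \<open>n + 1\<close> through rows \<open>n\<close> and \<open>n - 1\<close>, because the coefficient
  of \<open>f (n + 1) i\<close> is positive. This is the tool by which both differential equations below
  are reduced to the case \<open>n = 0\<close>.
\<close>
lemma recurrence_unique:
  assumes "satisfies_recurrence N x f" and "\<And>i. i \<le> N \<Longrightarrow> f 0 i = 0" and "i \<le> N"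
  shows "f n i = 0"
  using assms(3)
proof (induction n arbitrary: i rule: less_induct)
  case (less n)
  show ?case
  proof (cases n)
    case 0
    then show ?thesis using assms(2) less.prems by simp
  next
    case (Suc m)
    have z: "f m k = 0" if "k \<le> N" for k using less.IH[of m k] that Suc by simp
    have "f (m - 1) i = 0" using less.IH[of "m - 1" i] less.prems Suc by simp
    moreover have "horiz_coef N (Suc i) * f m (Suc i) = 0"
      using z[of "Suc i"] less.prems by (cases "i = N") simp_all
    ultimately have "raise N f m i + lower N f m i =
        vert_coef N (Suc m) * f (Suc m) i / (2 * ridx N m i)"
      using z[of "i - 1"] less.prems by (simp add: raise_def lower_def)
    moreover have "raise N f m i + lower N f m i = 0"
      using assms(1) less.prems z[of i] by (simp add: satisfies_recurrence_def)
    ultimately have "vert_coef N (Suc m) * f (Suc m) i / (2 * ridx N m i) = 0" by simp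
    moreover have "2 * ridx N m i \<noteq> 0" using less.prems by simp
    ultimately have "f (Suc m) i = 0"
      using vert_coef_Suc_pos[of N m] by (metis divide_eq_0_iff mult_eq_0_iff less_irrefl)
    then show ?thesis using Suc by simp
  qed
qed

section \<open>Differential equations for the rows\<close>

text \<open>
  For fixed \<open>n\<close> this is a matrix polynomial in \<open>x\<close>, the identity for \<open>n = 0\<close>. It is the
  multiple of the monic polynomial by a diagonal matrix for which the recurrence takes the
  symmetric form with the coefficients above; as a function on the group it is the spherical
  function normalised at the identity, written in terms of those with \<open>n = 0\<close>.
\<close>
fun spherical :: "nat \<Rightarrow> nat \<Rightarrow> nat \<Rightarrow> nat \<Rightarrow> real poly" where
  "spherical N 0 i j = (if i = j then 1 else 0)"
| "spherical N (Suc n) i j = Polynomial.smult (1 / vert_coef N (Suc n))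
     (Polynomial.smult (2 * lidx n i * ridx N n i) (pCons 0 (spherical N n i j))
      - Polynomial.smult (vert_coef N n) (spherical N (n - 1) i j)
      - Polynomial.smult (horiz_coef N (Suc i)) (spherical N n (Suc i) j)
      - Polynomial.smult (horiz_coef N i) (spherical N n (i - 1) j))"

lemma spherical_recurrence:
  "Polynomial.smult (2 * lidx n i * ridx N n i) (pCons 0 (spherical N n i j)) =
     Polynomial.smult (vert_coef N (Suc n)) (spherical N (Suc n) i j) + Polynomial.smult (vert_coef N n) (spherical N (n - 1) i j)
     + Polynomial.smult (horiz_coef N (Suc i)) (spherical N n (Suc i) j) + Polynomial.smult (horiz_coef N i) (spherical N n (i - 1) j)"
  using vert_coef_Suc_pos[of N n, THEN less_imp_neq] by simp

declare spherical.simps(2) [simp del]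

text \<open>
  The term \<open>g\<close> is \<open>0\<close> for the values of a solution; for its derivatives it is the term that
  the product rule adds.
\<close>
lemma recurrenceI:
  assumes "\<And>n i. i \<le> N \<Longrightarrow> 2 * lidx n i * ridx N n i * (x * f n i + g n i) =
     vert_coef N (Suc n) * f (Suc n) i + vert_coef N n * f (n - 1) i
     + horiz_coef N (Suc i) * f n (Suc i) + horiz_coef N i * f n (i - 1)"
    and "i \<le> N"
  shows "raise N f n i + lower N f n i = lidx n i * (x * f n i + g n i)"
proof -
  have "raise N f n i + lower N f n i =
      (2 * lidx n i * ridx N n i * (x * f n i + g n i)) / (2 * ridx N n i)"
    unfolding assms(1)[OF assms(2)] raise_def lower_def
    by (simp only: add_divide_distrib[symmetric] add_ac)
  also have "\<dots> = lidx n i * (x * f n i + g n i)"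
  proof -
    have "(2 * a * b * c) / (2 * b) = a * c" if "b > 0" for a b c :: real
      using that by simp
    note cancel = this
    show ?thesis by (rule cancel) (use assms(2) in simp)
  qed
  finally show ?thesis .
qed

lemma spherical_values:
  assumes "i \<le> N"
  shows "raise N (\<lambda>n i. poly (spherical N n i j) x) n i + lower N (\<lambda>n i. poly (spherical N n i j) x) n i =
    lidx n i * x * poly (spherical N n i j) x"
proof -
  have "2 * lidx n i * ridx N n i * (x * poly (spherical N n i j) x + 0) =
     vert_coef N (Suc n) * poly (spherical N (Suc n) i j) x + vert_coef N n * poly (spherical N (n - 1) i j) x
     + horiz_coef N (Suc i) * poly (spherical N n (Suc i) j) x + horiz_coef N i * poly (spherical N n (i - 1) j) x" for n i
    using arg_cong[OF spherical_recurrence[of n i N j], of "\<lambda>p. poly p x"]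
    by (simp add: algebra_simps)
  from recurrenceI[OF this assms] show ?thesis by (simp add: mult_ac)
qed

lemma spherical_derivs:
  assumes "i \<le> N"
  shows "raise N (\<lambda>n i. poly (pderiv (spherical N n i j)) x) n i
      + lower N (\<lambda>n i. poly (pderiv (spherical N n i j)) x) n i =
    lidx n i * (x * poly (pderiv (spherical N n i j)) x + poly (spherical N n i j) x)"
proof -
  have "2 * lidx n i * ridx N n i * (x * poly (pderiv (spherical N n i j)) x + poly (spherical N n i j) x) =
     vert_coef N (Suc n) * poly (pderiv (spherical N (Suc n) i j)) x + vert_coef N n * poly (pderiv (spherical N (n - 1) i j)) x
     + horiz_coef N (Suc i) * poly (pderiv (spherical N n (Suc i) j)) x + horiz_coef N i * poly (pderiv (spherical N n (i - 1) j)) x" for n i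
    using arg_cong[OF spherical_recurrence[of n i N j], of "\<lambda>p. poly (pderiv p) x"]
    by (simp add: pderiv_add pderiv_smult pderiv_pCons algebra_simps)
  from recurrenceI[OF this assms] show ?thesis by simp
qed

lemma spherical_derivs2:
  assumes "i \<le> N"
  shows "raise N (\<lambda>n i. poly (pderiv (pderiv (spherical N n i j))) x) n i
      + lower N (\<lambda>n i. poly (pderiv (pderiv (spherical N n i j))) x) n i =
    lidx n i * (x * poly (pderiv (pderiv (spherical N n i j))) x + 2 * poly (pderiv (spherical N n i j)) x)"
proof -
  have "2 * lidx n i * ridx N n i * (x * poly (pderiv (pderiv (spherical N n i j))) x + 2 * poly (pderiv (spherical N n i j)) x) =
     vert_coef N (Suc n) * poly (pderiv (pderiv (spherical N (Suc n) i j))) x + vert_coef N n * poly (pderiv (pderiv (spherical N (n - 1) i j))) x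
     + horiz_coef N (Suc i) * poly (pderiv (pderiv (spherical N n (Suc i) j))) x + horiz_coef N i * poly (pderiv (pderiv (spherical N n (i - 1) j))) x" for n i
    using arg_cong[OF spherical_recurrence[of n i N j], of "\<lambda>p. poly (pderiv (pderiv p)) x"]
    by (simp add: pderiv_add pderiv_smult pderiv_pCons algebra_simps)
  from recurrenceI[OF this assms] show ?thesis by simp
qed

lemma raise_add: "raise N (\<lambda>n i. f n i + g n i) n i = raise N f n i + raise N g n i"
  and raise_diff: "raise N (\<lambda>n i. f n i - g n i) n i = raise N f n i - raise N g n i"
  and raise_mult: "raise N (\<lambda>n i. c * f n i) n i = c * raise N f n i"
  by (simp_all add: raise_def add_divide_distrib diff_divide_distrib algebra_simps)

lemma lower_add: "lower N (\<lambda>n i. f n i + g n i) n i = lower N f n i + lower N g n i"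
  and lower_diff: "lower N (\<lambda>n i. f n i - g n i) n i = lower N f n i - lower N g n i"
  and lower_mult: "lower N (\<lambda>n i. c * f n i) n i = c * lower N f n i"
  by (simp_all add: lower_def add_divide_distrib diff_divide_distrib algebra_simps)

lemma raise_cong:
  assumes "\<And>n i. i \<le> N \<Longrightarrow> f n i = g n i" and "i \<le> N"
  shows "raise N f n i = raise N g n i"
  using assms by (cases "i = N") (simp_all add: raise_def)

lemma lower_cong:
  assumes "\<And>n i. i \<le> N \<Longrightarrow> f n i = g n i" and "i \<le> N"
  shows "lower N f n i = lower N g n i"
  using assms by (simp add: lower_def)

text \<open>
  The first-order operator on the left acts on the column index, the difference of the
  lowering and the raising operator on the row label. Each side satisfies the recurrence up to
  the extra term \<open>lidx n i\<close> times \<open>1 - x\<^sup>2\<close> times the row: on the left by the product rule, on the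
  right by the \<open>sl(2)\<close> relation. Hence the difference of the two sides solves the recurrence, and it
  vanishes for \<open>n = 0\<close>.
\<close>
lemma spherical_first_order:
  assumes "i \<le> N"
  shows "(1 - x\<^sup>2) * poly (pderiv (spherical N n i j)) x
      - (real j + 1) * (x * poly (spherical N n i j) x) + (real j + 1) * poly (spherical N n i (Suc j)) x =
    lower N (\<lambda>n i. poly (spherical N n i j) x) n i - raise N (\<lambda>n i. poly (spherical N n i j) x) n i"
proof -
  define r where "r = (\<lambda>n i. poly (spherical N n i j) x)"
  define s where "s = (\<lambda>n i. poly (spherical N n i (Suc j)) x)"
  define d where "d = (\<lambda>n i. poly (pderiv (spherical N n i j)) x)"
  have r: "raise N r n i + lower N r n i = lidx n i * (x * r n i)" if "i \<le> N" for n i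
    using spherical_values[OF that, of j x n] by (simp add: r_def algebra_simps)
  have s: "raise N s n i + lower N s n i = lidx n i * (x * s n i)" if "i \<le> N" for n i
    using spherical_values[OF that, of "Suc j" x n] by (simp add: s_def algebra_simps)
  have d: "raise N d n i + lower N d n i = lidx n i * (x * d n i + r n i)" if "i \<le> N" for n i
    using spherical_derivs[OF that, of j x n] by (simp add: r_def d_def)
  define e where "e = (\<lambda>n i. (1 - x\<^sup>2) * d n i - (real j + 1) * (x * r n i)
    + (real j + 1) * s n i + (raise N r n i - lower N r n i))"
  have "raise N e n i + lower N e n i = lidx n i * x * e n i" if i: "i \<le> N" for n i
  proof -
    let ?rr = "raise N (raise N r) n i" and ?rl = "raise N (lower N r) n i"
    let ?lr = "lower N (raise N r) n i" and ?ll = "lower N (lower N r) n i"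
    have "?rr + ?rl = raise N (\<lambda>n i. lidx n i * (x * r n i)) n i"
      unfolding raise_add[symmetric] using r i by (rule raise_cong)
    also have "\<dots> = (lidx n i + 1) * (x * raise N r n i)"
      by (simp only: raise_lidx raise_mult)
    finally have 1: "?rr + ?rl = (lidx n i + 1) * (x * raise N r n i)" .
    have "?lr + ?ll = lower N (\<lambda>n i. lidx n i * (x * r n i)) n i"
      unfolding lower_add[symmetric] using r i by (rule lower_cong)
    also have "\<dots> = (lidx n i - 1) * (x * lower N r n i)"
      by (simp only: lower_lidx lower_mult)
    finally have 2: "?lr + ?ll = (lidx n i - 1) * (x * lower N r n i)" .
    have 3: "?rl - ?lr = lidx n i / 2 * r n i"
      by (rule raise_lower_commutator[OF i])
    have "raise N e n i + lower N e n i =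
        (1 - x\<^sup>2) * (raise N d n i + lower N d n i)
        - (real j + 1) * (x * (raise N r n i + lower N r n i))
        + (real j + 1) * (raise N s n i + lower N s n i) + ((?rr - ?rl) + (?lr - ?ll))"
      unfolding e_def by (simp only: raise_add raise_diff raise_mult lower_add lower_diff lower_mult)
        (simp add: algebra_simps)
    \<comment> \<open>Arranged so that the recurrence applies to the sums and the commutator to the last term.\<close>
    also have "(?rr - ?rl) + (?lr - ?ll) = (?rr + ?rl) - (?lr + ?ll) - 2 * (?rl - ?lr)" by simp
    also have "\<dots> = lidx n i * x * (raise N r n i - lower N r n i)
        + x * (raise N r n i + lower N r n i) - lidx n i * r n i"
      unfolding 1 2 3 by (simp add: algebra_simps)
    finally show ?thesis
      unfolding r[OF i] s[OF i] d[OF i] e_def by (simp add: algebra_simps power2_eq_square)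
  qed
  then have "satisfies_recurrence N x e" by (simp add: satisfies_recurrence_def)
  moreover have "e 0 i = 0" if i: "i \<le> N" for i
  proof -
    have "lower N r 0 i = (real j + 1) / 2 * s 0 i"
    proof (cases i)
      case 0
      then show ?thesis by (simp add: lower_def s_def)
    next
      case (Suc k)
      then have "real k < real N" using i by simp
      then show ?thesis using Suc
        by (auto simp add: lower_def r_def s_def horiz_coef_def) (simp add: divide_simps, simp add: algebra_simps)
    qed
    moreover have "(1 - x\<^sup>2) * d 0 i = 0" by (simp add: d_def)
    moreover have "lidx 0 i * (x * r 0 i) = (real j + 1) * (x * r 0 i)" by (simp add: r_def)
    ultimately show ?thesis using r[OF i, of 0] by (simp only: e_def)
  qed
  ultimately have "e n i = 0" using recurrence_unique assms by blast
  then show ?thesis unfolding e_def d_def s_def r_def by (simp add: algebra_simps)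
qed

text \<open>
  Up to sign and an additive constant the operator is the Casimir operator of the left copy of
  \<open>SU(2)\<close>; its diagonal part is the operator of the Gegenbauer polynomials \<open>C\<^sup>(\<^sup>j\<^sup>+\<^sup>1\<^sup>)\<close>. The
  difference of the two sides again solves the recurrence: the commutator of the operator with \<open>x\<close>
  is twice the first-order operator of the previous lemma minus \<open>x\<close>, and that lemma turns it into
  the terms that \<open>(lidx \<plusminus> 1)\<^sup>2 = lidx\<^sup>2 \<plusminus> 2 lidx + 1\<close> produces on the other side.
\<close>
lemma spherical_second_order:
  assumes "i \<le> N"
  shows "(1 - x\<^sup>2) * poly (pderiv (pderiv (spherical N n i j))) x
      - (2 * real j + 3) * (x * poly (pderiv (spherical N n i j)) x)
      + 2 * (real j + 1) * poly (pderiv (spherical N n i (Suc j))) x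
      - (real j + 1)\<^sup>2 * poly (spherical N n i j) x =
    - (lidx n i)\<^sup>2 * poly (spherical N n i j) x"
proof -
  define r where "r = (\<lambda>n i. poly (spherical N n i j) x)"
  define d where "d = (\<lambda>n i. poly (pderiv (spherical N n i j)) x)"
  define d2 where "d2 = (\<lambda>n i. poly (pderiv (pderiv (spherical N n i j))) x)"
  define s where "s = (\<lambda>n i. poly (spherical N n i (Suc j)) x)"
  define t where "t = (\<lambda>n i. poly (pderiv (spherical N n i (Suc j))) x)"
  have r: "raise N r n i + lower N r n i = lidx n i * (x * r n i)" if "i \<le> N" for n i
    using spherical_values[OF that, of j x n] by (simp add: r_def algebra_simps)
  have d: "raise N d n i + lower N d n i = lidx n i * (x * d n i + r n i)" if "i \<le> N" for n i
    using spherical_derivs[OF that, of j x n] by (simp add: r_def d_def)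
  have t: "raise N t n i + lower N t n i = lidx n i * (x * t n i + s n i)" if "i \<le> N" for n i
    using spherical_derivs[OF that, of "Suc j" x n] by (simp add: s_def t_def)
  have d2: "raise N d2 n i + lower N d2 n i = lidx n i * (x * d2 n i + 2 * d n i)" if "i \<le> N" for n i
    using spherical_derivs2[OF that, of j x n] by (simp add: d_def d2_def)
  define e where "e = (\<lambda>n i. (1 - x\<^sup>2) * d2 n i - (2 * real j + 3) * (x * d n i)
    + 2 * (real j + 1) * t n i - (real j + 1)\<^sup>2 * r n i + lidx n i * (lidx n i * r n i))"
  have "raise N e n i + lower N e n i = lidx n i * x * e n i" if i: "i \<le> N" for n i
  proof -
    have fo: "(1 - x\<^sup>2) * d n i - (real j + 1) * (x * r n i) + (real j + 1) * s n i
        + raise N r n i - lower N r n i = 0"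
      using spherical_first_order[OF i, of x n j] by (simp add: r_def d_def s_def)
    have "raise N e n i + lower N e n i =
        (1 - x\<^sup>2) * (raise N d2 n i + lower N d2 n i)
        - (2 * real j + 3) * (x * (raise N d n i + lower N d n i))
        + 2 * (real j + 1) * (raise N t n i + lower N t n i)
        - (real j + 1)\<^sup>2 * (raise N r n i + lower N r n i)
        + ((lidx n i + 1)\<^sup>2 * raise N r n i + (lidx n i - 1)\<^sup>2 * lower N r n i)"
      unfolding e_def by (simp only: raise_add raise_diff raise_mult lower_add lower_diff lower_mult
          raise_lidx lower_lidx) (simp add: algebra_simps power2_eq_square)
    also have "(lidx n i + 1)\<^sup>2 * raise N r n i + (lidx n i - 1)\<^sup>2 * lower N r n i =
        ((lidx n i)\<^sup>2 + 1) * (raise N r n i + lower N r n i)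
        + 2 * lidx n i * (raise N r n i - lower N r n i)"
      by (simp add: algebra_simps power2_eq_square)
    finally have "raise N e n i + lower N e n i = lidx n i * x * e n i
        + 2 * lidx n i * ((1 - x\<^sup>2) * d n i - (real j + 1) * (x * r n i) + (real j + 1) * s n i
        + raise N r n i - lower N r n i)"
      unfolding r[OF i] t[OF i] d[OF i] d2[OF i] e_def by (simp add: algebra_simps power2_eq_square)
    then show ?thesis unfolding fo by simp
  qed
  then have "satisfies_recurrence N x e" by (simp add: satisfies_recurrence_def)
  moreover have "e 0 i = 0" if i: "i \<le> N" for i
    by (simp add: e_def r_def d_def d2_def t_def power2_eq_square)
  ultimately have "e n i = 0" using recurrence_unique assms by blast
  then show ?thesis unfolding e_def d_def d2_def t_def r_def
    by (simp add: algebra_simps power2_eq_square)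
qed

text \<open>
  Exchanging the two copies of \<open>SU(2)\<close> replaces \<open>i\<close> by \<open>N - i\<close> and swaps the two dimensions.
  This symmetry turns statements on the left dimension into statements on the right one.
\<close>
lemma spherical_reflect:
  "i \<le> N \<Longrightarrow> j \<le> N \<Longrightarrow> spherical N n (N - i) (N - j) = spherical N n i j"
proof (induction n arbitrary: i rule: less_induct)
  case (less n)
  show ?case
  proof (cases n)
    case 0
    then show ?thesis using less.prems by auto
  next
    case (Suc m)
    have a: "spherical N m (N - i) (N - j) = spherical N m i j" using less Suc by simp
    have b: "spherical N (m - 1) (N - i) (N - j) = spherical N (m - 1) i j" using less Suc by simp
    have c: "Polynomial.smult (horiz_coef N (Suc (N - i))) (spherical N m (Suc (N - i)) (N - j)) =
        Polynomial.smult (horiz_coef N i) (spherical N m (i - 1) j)"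
    proof (cases i)
      case (Suc k)
      then have "Suc (N - i) = N - k" using less.prems by simp
      moreover have "horiz_coef N (N - k) = horiz_coef N i"
        using less.prems Suc by (simp add: horiz_coef_def of_nat_diff mult_ac)
      moreover have "spherical N m (N - k) (N - j) = spherical N m k j"
        using less.IH[of m k] less.prems Suc \<open>n = Suc m\<close> by simp
      ultimately show ?thesis using Suc by simp
    qed simp
    have d: "Polynomial.smult (horiz_coef N (N - i)) (spherical N m (N - i - 1) (N - j)) =
        Polynomial.smult (horiz_coef N (Suc i)) (spherical N m (Suc i) j)"
    proof (cases "i = N")
      case False
      then have "horiz_coef N (N - i) = horiz_coef N (Suc i)"
        using less.prems by (simp add: horiz_coef_def of_nat_diff mult_ac)
      moreover have "spherical N m (N - Suc i) (N - j) = spherical N m (Suc i) j"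
        using less.IH[of m "Suc i"] less.prems False \<open>n = Suc m\<close> by simp
      ultimately show ?thesis by simp
    qed simp
    have e: "2 * lidx m (N - i) * ridx N m (N - i) = 2 * lidx m i * ridx N m i"
      using less.prems by (simp add: algebra_simps)
    show ?thesis unfolding Suc spherical.simps(2) a b c d e by (simp add: algebra_simps)
  qed
qed

lemma spherical_column_out_of_range: "i \<le> N \<Longrightarrow> N < j \<Longrightarrow> spherical N n i j = 0"
proof (induction n arbitrary: i rule: less_induct)
  case (less n)
  show ?case
  proof (cases n)
    case 0
    then show ?thesis using less.prems by auto
  next
    case (Suc m)
    have "spherical N m k j = 0" "spherical N (m - 1) k j = 0" if "k \<le> N" for k
      using less.IH that Suc less.prems by simp_all
    then show ?thesis using less.prems unfolding Suc by (cases "i = N") (simp_all add: spherical.simps(2))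
  qed
qed

text \<open>
  The diagonal entry by which row \<open>i\<close> of the \<open>n\<close>-th matrix has to be multiplied to become
  monic.
\<close>
definition monic_factor :: "nat \<Rightarrow> nat \<Rightarrow> nat \<Rightarrow> real" where
  "monic_factor N n i = (\<Prod>k<n. vert_coef N (Suc k) / (2 * lidx k i * ridx N k i))"

lemma coeff_spherical:
  "i \<le> N \<Longrightarrow> n \<le> k \<Longrightarrow>
    coeff (spherical N n i j) k = (if i = j \<and> k = n then 1 / monic_factor N n i else 0)"
proof (induction n arbitrary: i k rule: less_induct)
  case (less n)
  show ?case
  proof (cases n)
    case 0
    then show ?thesis using less.prems by (auto simp: coeff_1 monic_factor_def)
  next
    case (Suc m)
    obtain p where k: "k = Suc p" "m \<le> p" using less.prems Suc by (cases k) auto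
    have z: "coeff (spherical N l a j) k = 0" if "a \<le> N" "l \<le> m" for l a
      using less.IH[of l a k] that Suc k by simp
    have "horiz_coef N (Suc i) * coeff (spherical N m (Suc i) j) k = 0"
      using z[of "Suc i" m] less.prems by (cases "i = N") simp_all
    moreover have "coeff (spherical N (m - 1) i j) k = 0" "coeff (spherical N m (i - 1) j) k = 0"
      using z less.prems by simp_all
    ultimately have "coeff (spherical N (Suc m) i j) k =
        2 * lidx m i * ridx N m i * coeff (spherical N m i j) p / vert_coef N (Suc m)"
      by (simp add: spherical.simps(2)) (simp add: k)
    also have "coeff (spherical N m i j) p = (if i = j \<and> p = m then 1 / monic_factor N m i else 0)"
      using less.IH[of m i p] less.prems Suc k by simp
    finally show ?thesis using k Suc by (simp add: monic_factor_def)
  qed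
qed

section \<open>Chebyshev polynomials and the semicircle weight\<close>

fun chebU :: "nat \<Rightarrow> real poly" where
  "chebU 0 = 1"
| "chebU (Suc 0) = [:0, 2:]"
| "chebU (Suc (Suc n)) = [:0, 2:] * chebU (Suc n) - chebU n"

fun chebT :: "nat \<Rightarrow> real poly" where
  "chebT 0 = 1"
| "chebT (Suc 0) = [:0, 1:]"
| "chebT (Suc (Suc n)) = [:0, 2:] * chebT (Suc n) - chebT n"

lemma poly_chebU: "poly (chebU n) x = cheb_U n x"
  by (induction n rule: chebU.induct) simp_all

lemma poly_chebU_rec:
  "poly (chebU (Suc (Suc n))) x = 2 * x * poly (chebU (Suc n)) x - poly (chebU n) x"
  by simp

lemma poly_chebT_Suc: "poly (chebT (Suc n)) x = poly (chebU (Suc n)) x - x * poly (chebU n) x"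
proof (induction n rule: chebU.induct)
  case (3 n)
  have "poly (chebT (Suc (Suc (Suc n)))) x =
      2 * x * poly (chebT (Suc (Suc n))) x - poly (chebT (Suc n)) x"
    by simp
  then show ?case unfolding 3 poly_chebU_rec by (simp add: algebra_simps)
qed simp_all

lemma chebT_Suc_Suc: "chebT (Suc (Suc n)) = Polynomial.smult (1/2) (chebU (Suc (Suc n)) - chebU n)"
  by (rule iffD1[OF poly_eq_poly_eq_iff], rule ext)
    (simp only: poly_chebT_Suc poly_smult poly_diff poly_chebU_rec, simp add: algebra_simps)

lemma pderiv_chebT: "poly (pderiv (chebT (Suc n))) x = (real n + 1) * poly (chebU n) x"
proof (induction n rule: chebU.induct)
  case (3 n)
  have "poly (pderiv (chebT (Suc (Suc (Suc n))))) x =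
      2 * poly (chebT (Suc (Suc n))) x + 2 * x * poly (pderiv (chebT (Suc (Suc n)))) x
      - poly (pderiv (chebT (Suc n))) x"
    by (simp add: pderiv_diff pderiv_smult pderiv_mult pderiv_pCons algebra_simps)
  then show ?case
    unfolding 3 poly_chebT_Suc poly_chebU_rec by (simp add: algebra_simps)
qed (simp_all add: pderiv_diff pderiv_smult pderiv_mult pderiv_pCons algebra_simps)

lemma pderiv_chebU:
  "(1 - x\<^sup>2) * poly (pderiv (chebU n)) x = x * poly (chebU n) x - (real n + 1) * poly (chebT (Suc n)) x"
proof (induction n rule: chebU.induct)
  case (3 n)
  have "(1 - x\<^sup>2) * poly (pderiv (chebU (Suc (Suc n)))) x =
      2 * (1 - x\<^sup>2) * poly (chebU (Suc n)) x + 2 * x * ((1 - x\<^sup>2) * poly (pderiv (chebU (Suc n))) x)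
      - (1 - x\<^sup>2) * poly (pderiv (chebU n)) x"
    by (simp add: pderiv_diff pderiv_smult pderiv_mult pderiv_pCons algebra_simps)
  then show ?case
    unfolding 3 poly_chebT_Suc poly_chebU_rec
    by (simp add: algebra_simps power2_eq_square)
qed (simp_all add: pderiv_diff pderiv_smult pderiv_mult pderiv_pCons algebra_simps power2_eq_square)

text \<open>
  Since \<open>2 x T\<^sub>k = T\<^sub>k\<^sub>+\<^sub>1 + T\<^sub>k\<^sub>-\<^sub>1\<close>, the span of the \<open>T\<^sub>k\<close> is closed under multiplication by
  \<open>x\<close>, hence contains all polynomials.
\<close>
lemma cheb_span_induct:
  assumes "\<And>k. Q (chebT k)" and "\<And>p q. Q p \<Longrightarrow> Q q \<Longrightarrow> Q (p + q)"
    and "\<And>c p. Q p \<Longrightarrow> Q (Polynomial.smult c p)"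
  shows "Q p"
proof -
  have x: "[:0, 1:] * chebT k = (if k = 0 then chebT 1 else
      Polynomial.smult (1/2) (chebT (Suc k) + chebT (k - 1)))" for k
    by (cases k) (simp_all add: smult_diff_right)
  have "Q (p * chebT k)" for k
  proof (induction p arbitrary: k)
    case 0
    then show ?case using assms(3)[OF assms(1)[of 0], of 0] by simp
  next
    case (pCons a p)
    have "pCons a p * chebT k = Polynomial.smult a (chebT k) + p * ([:0, 1:] * chebT k)"
      by simp
    moreover have "Q (p * ([:0, 1:] * chebT k))"
    proof (cases "k = 0")
      case True
      show ?thesis unfolding x if_P[OF True] by (rule pCons.IH)
    next
      case False
      have "Q (Polynomial.smult (1/2) (p * chebT (Suc k) + p * chebT (k - 1)))"
        by (intro assms pCons)
      then show ?thesis unfolding x using False by (simp add: distrib_left)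
    qed
    ultimately have "Q (pCons a p * chebT k)" by (simp only: assms)
    then show ?case .
  qed
  from this[of 0] show ?thesis by simp
qed

definition semicircle :: "real poly \<Rightarrow> real" where
  "semicircle p = integral {-1..1} (\<lambda>x. sqrt (1 - x\<^sup>2) * poly p x)"

lemma semicircle_integrable: "(\<lambda>x. sqrt (1 - x\<^sup>2) * poly p x) integrable_on {-1..1::real}"
  by (intro integrable_continuous_interval continuous_intros)

lemma semicircle_add: "semicircle (p + q) = semicircle p + semicircle q"
  unfolding semicircle_def using integral_add[OF semicircle_integrable semicircle_integrable, of p q]
  by (simp add: algebra_simps)

lemma semicircle_smult: "semicircle (Polynomial.smult c p) = c * semicircle p"
  unfolding semicircle_def
  by (simp add: mult.left_commute[of _ c] flip: integral_mult_right)

lemma semicircle_0 [simp]: "semicircle 0 = 0"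
  by (simp add: semicircle_def)

lemma semicircle_diff: "semicircle (p - q) = semicircle p - semicircle q"
  using semicircle_add[of p "Polynomial.smult (-1) q"] semicircle_smult[of "-1" q] by simp

lemma semicircle_sum: "semicircle (\<Sum>a\<in>A. f a) = (\<Sum>a\<in>A. semicircle (f a))"
  by (induction A rule: infinite_finite_induct) (simp_all add: semicircle_add)

lemma semicircle_1_nonzero: "semicircle 1 \<noteq> 0"
proof
  assume "semicircle 1 = 0"
  then have *: "integral {-1..1} (\<lambda>x. sqrt (1 - x\<^sup>2)) = 0" by (simp add: semicircle_def)
  have c: "continuous_on {-1..1::real} (\<lambda>x. sqrt (1 - x\<^sup>2))" by (intro continuous_intros)
  have "sqrt (1 - x\<^sup>2) \<ge> 0" if "x \<in> {-1..1}" for x :: real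
    using that by (simp add: abs_square_le_1 abs_le_iff)
  with * c have "\<forall>x\<in>{-1..1::real}. sqrt (1 - x\<^sup>2) = 0"
    by (subst (asm) integral_eq_0_iff) auto
  from bspec[OF this, of 0] show False by simp
qed

text \<open>
  In the variable \<open>\<theta>\<close> with \<open>x = cos \<theta>\<close> the integrand is
  \<open>sin ((k + 2) \<theta>) sin \<theta>\<close>, whose antiderivative is a combination of \<open>sin ((k + 1) \<theta>)\<close> and
  \<open>sin ((k + 3) \<theta>)\<close>; written in \<open>x\<close>, it is \<open>F\<close> and vanishes at both end points.
\<close>
lemma semicircle_chebU_Suc: "semicircle (chebU (Suc k)) = 0"
proof -
  define q where "q = Polynomial.smult (1 / (2 * (real k + 1))) (chebU k)
    - Polynomial.smult (1 / (2 * (real k + 3))) (chebU (Suc (Suc k)))"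
  define F where "F = (\<lambda>x. sqrt (1 - x\<^sup>2) * poly q x)"
  have key: "(1 - x\<^sup>2) * poly (pderiv q) x - x * poly q x = - (1 - x\<^sup>2) * poly (chebU (Suc k)) x" for x
  proof -
    have "(1 - x\<^sup>2) * poly (pderiv q) x - x * poly q x =
        ((1 - x\<^sup>2) * poly (pderiv (chebU k)) x - x * poly (chebU k) x) / (2 * (real k + 1))
        - ((1 - x\<^sup>2) * poly (pderiv (chebU (Suc (Suc k)))) x - x * poly (chebU (Suc (Suc k))) x) / (2 * (real k + 3))"
      by (simp add: q_def pderiv_diff pderiv_smult diff_divide_distrib add_divide_distrib algebra_simps del: chebU.simps)
    also have "\<dots> = - poly (chebT (Suc k)) x / 2 + poly (chebT (Suc (Suc (Suc k)))) x / 2"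
      unfolding pderiv_chebU by (simp add: divide_simps) (simp add: algebra_simps)
    also have "\<dots> = - (1 - x\<^sup>2) * poly (chebU (Suc k)) x"
      unfolding poly_chebT_Suc poly_chebU_rec by (simp add: field_simps power2_eq_square)
    finally show ?thesis .
  qed
  have "(F has_vector_derivative - (sqrt (1 - x\<^sup>2) * poly (chebU (Suc k)) x)) (at x)"
    if "x \<in> {-1<..<1}" for x
  proof -
    have pos: "1 - x\<^sup>2 > 0" using that by (simp add: abs_square_less_1 abs_less_iff)
    have "(F has_real_derivative (- (2 * x) * (inverse (sqrt (1 - x\<^sup>2)) / 2)) * poly q x
        + poly (pderiv q) x * sqrt (1 - x\<^sup>2)) (at x)"
      unfolding F_def
      by (rule derivative_eq_intros poly_DERIV refl | use pos in simp)+
    also have "(- (2 * x) * (inverse (sqrt (1 - x\<^sup>2)) / 2)) * poly q x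
        + poly (pderiv q) x * sqrt (1 - x\<^sup>2) =
        ((1 - x\<^sup>2) * poly (pderiv q) x - x * poly q x) / sqrt (1 - x\<^sup>2)"
      using pos by (simp add: field_simps flip: real_sqrt_mult)
    also have "\<dots> = - (sqrt (1 - x\<^sup>2) * poly (chebU (Suc k)) x)"
    proof -
      have "1 - x\<^sup>2 = sqrt (1 - x\<^sup>2) * sqrt (1 - x\<^sup>2)" using pos by simp
      then have "(1 - x\<^sup>2) / sqrt (1 - x\<^sup>2) = sqrt (1 - x\<^sup>2)" using pos
        by (metis less_irrefl nonzero_mult_div_cancel_right real_sqrt_gt_zero)
      moreover have "- a * b / c = - (a / c * b)" for a b c :: real
        by simp
      ultimately show ?thesis unfolding key by metis
    qed
    finally show ?thesis by (simp add: has_real_derivative_iff_has_vector_derivative)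
  qed
  moreover have "continuous_on {-1..1} F" unfolding F_def by (intro continuous_intros)
  ultimately have "((\<lambda>x. - (sqrt (1 - x\<^sup>2) * poly (chebU (Suc k)) x)) has_integral (F 1 - F (-1))) {-1..1}"
    by (intro fundamental_theorem_of_calculus_interior) auto
  then have "((\<lambda>x. sqrt (1 - x\<^sup>2) * poly (chebU (Suc k)) x) has_integral 0) {-1..1}"
    by (auto simp: F_def dest: has_integral_neg)
  then show ?thesis unfolding semicircle_def by (rule integral_unique)
qed

text \<open>
  Multiplication by \<open>2 x\<close> can be moved from one factor to the other, which lowers \<open>k\<close> and
  reduces everything to the case \<open>k = 0\<close>.
\<close>
lemma semicircle_chebU_orthogonal:
  "semicircle (chebU j * chebU k) = (if j = k then semicircle 1 else 0)"
proof (induction k arbitrary: j rule: chebU.induct)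
  case 1
  then show ?case by (cases j) (simp_all add: semicircle_chebU_Suc)
next
  case 2
  show ?case
  proof (cases j)
    case 0
    then show ?thesis using semicircle_chebU_Suc[of 0] by simp
  next
    case (Suc i)
    have "chebU (Suc i) * chebU (Suc 0) = chebU (Suc (Suc i)) + chebU i" by simp
    then show ?thesis using Suc
      by (cases i) (simp_all add: semicircle_add semicircle_chebU_Suc del: chebU.simps(2,3))
  qed
next
  case (3 k)
  show ?case
  proof (cases j)
    case 0
    then show ?thesis using semicircle_chebU_Suc[of "Suc k"] by simp
  next
    case (Suc i)
    have "chebU j * chebU (Suc (Suc k)) =
        ([:0, 2:] * chebU (Suc i)) * chebU (Suc k) - chebU j * chebU k"
      using Suc by (simp add: algebra_simps)
    also have "[:0, 2:] * chebU (Suc i) = chebU (Suc (Suc i)) + chebU i" by simp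
    also have "(chebU (Suc (Suc i)) + chebU i) * chebU (Suc k) - chebU j * chebU k =
        chebU (Suc (Suc i)) * chebU (Suc k) + chebU i * chebU (Suc k) - chebU j * chebU k"
      by (simp only: distrib_right)
    finally show ?thesis
      using 3 Suc by (simp add: semicircle_add semicircle_diff del: chebU.simps(2,3))
  qed
qed

section \<open>The moments of the weight\<close>

text \<open>
  The reciprocal factorial, extended by \<open>0\<close> to the negative integers as the values of
  \<open>1 / \<Gamma>\<close> suggest. With this convention the contiguous relations of the weight coefficients hold
  for all integers \<open>t\<close>, without conditions on the range of summation.
\<close>
definition rfact :: "int \<Rightarrow> real" where
  "rfact z = (if z < 0 then 0 else 1 / fact (nat z))"

lemma rfact_diff_1: "rfact (z - 1) = of_int z * rfact z"
proof (cases "z \<le> 0")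
  case False
  then have "nat z = Suc (nat (z - 1))" by linarith
  then show ?thesis using False by (simp add: rfact_def)
qed (auto simp: rfact_def)

lemma rfact_of_nat: "rfact (int n) = 1 / fact n"
  by (simp add: rfact_def)

text \<open>
  The coefficient \<open>\<alpha>\<^sub>t\<close> of the weight in a form that is symmetric in its two indices and
  shows the invariance under \<open>i \<mapsto> N - i\<close>.
\<close>
definition fourier_coef :: "nat \<Rightarrow> nat \<Rightarrow> nat \<Rightarrow> int \<Rightarrow> real" where
  "fourier_coef N a b t = (real N + 1)\<^sup>2 * (fact a * fact b * fact (N - a) * fact (N - b))
     * (rfact t * rfact (int a + int b + 1 - t) * rfact (int N + 1 - t) * rfact (int N - int a - int b + t))"

lemma fourier_coef_commute: "fourier_coef N a b t = fourier_coef N b a t"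
  by (simp add: fourier_coef_def algebra_simps)

lemma fourier_coef_neg: "t < 0 \<Longrightarrow> fourier_coef N a b t = 0"
  by (simp add: fourier_coef_def rfact_def)

lemma fourier_coef_reflect:
  assumes "a \<le> N" "b \<le> N"
  shows "fourier_coef N (N - a) (N - b) (int N - int a - int b + t) = fourier_coef N a b t"
  using assms by (simp add: fourier_coef_def of_nat_diff algebra_simps)

lemma pochhammer_neg_rfact:
  "(- 1) ^ s * pochhammer (- real p) s = fact p * rfact (int p - int s)"
proof (induction s)
  case 0
  then show ?case by (simp add: rfact_of_nat)
next
  case (Suc s)
  have "(- 1) ^ Suc s * pochhammer (- real p) (Suc s) =
      (real p - real s) * ((- 1) ^ s * pochhammer (- real p) s)"
    by (simp add: pochhammer_Suc algebra_simps)
  also have "\<dots> = fact p * (of_int (int p - int s) * rfact (int p - int s))"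
    unfolding Suc by simp
  also have "\<dots> = fact p * rfact (int p - int (Suc s))"
    unfolding rfact_diff_1[symmetric] by (simp add: algebra_simps)
  finally show ?case .
qed

lemma pochhammer_fact_quotient: "pochhammer (real p + 1) s = fact (p + s) / fact p"
  by (induction s) (simp_all add: pochhammer_Suc algebra_simps add_divide_distrib)

text \<open>
  The Pochhammer symbol of \<open>n - N\<close> vanishes for \<open>m - t > N - n\<close>; this is the case in which the
  last reciprocal factorial has a negative argument.
\<close>
lemma weight_coeff_eq:
  assumes "t \<le> m" "m \<le> n" "n \<le> N"
  shows "weight_coeff N t m n = fourier_coef N n m (int t)"
proof -
  have 1: "(- 1) ^ (m - t) * pochhammer (real n - real N) (m - t) =
      fact (N - n) * rfact (int N - int n - int m + int t)"
    using pochhammer_neg_rfact[of "m - t" "N - n"] assms by (simp add: of_nat_diff algebra_simps)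
  have 2: "pochhammer (real n + 2) (m - t) = fact (n + m + 1 - t) / fact (n + 1)"
  proof -
    have eq: "n + 1 + (m - t) = n + m + 1 - t" "real (n + 1) + 1 = real n + 2" using assms by auto
    show ?thesis using pochhammer_fact_quotient[of "n + 1" "m - t"] unfolding eq .
  qed
  have 3: "pochhammer (real N + 2 - real t) t = fact (N + 1) / fact (N + 1 - t)"
  proof -
    have eq: "N + 1 - t + t = N + 1" "real (N + 1 - t) + 1 = real N + 2 - real t"
      using assms by (auto simp: of_nat_diff)
    show ?thesis using pochhammer_fact_quotient[of "N + 1 - t" t] unfolding eq .
  qed
  have 4: "rfact (int n + int m + 1 - int t) = 1 / fact (n + m + 1 - t)"
    using rfact_of_nat[of "n + m + 1 - t"] assms by (simp add: of_nat_diff algebra_simps)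
  have 5: "rfact (int N + 1 - int t) = 1 / fact (N + 1 - t)"
    using rfact_of_nat[of "N + 1 - t"] assms by (simp add: of_nat_diff algebra_simps)
  have "weight_coeff N t m n = (real N + 1) / (real n + 1) * (fact (N - m) * fact m / fact N)
     * ((- 1) ^ (m - t) * pochhammer (real n - real N) (m - t)) / pochhammer (real n + 2) (m - t)
     * (pochhammer (real N + 2 - real t) t / fact t)"
    by (simp add: weight_coeff_def)
  also have "\<dots> = fourier_coef N n m (int t)"
  proof -
    have f: "fact (n + 1) = (real n + 1) * fact n" "fact (N + 1) = (real N + 1) * fact N" by simp_all
    have "N' / n' * (fNm * fm / fN) * (fNn * r) / (f1 / (n' * fn)) * ((N' * fN) / f2 / ft) =
        N'\<^sup>2 * (fn * fm * fNn * fNm) * (1 / ft * (1 / f1) * (1 / f2) * r)"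
      if "n' \<noteq> 0" "fN \<noteq> 0" "f1 \<noteq> 0" "f2 \<noteq> 0" "ft \<noteq> 0"
      for N' n' fNm fm fN fNn r f1 fn f2 ft :: real
      using that by (simp add: field_simps power2_eq_square)
    note rearrange = this
    show ?thesis unfolding 1 2 3 fourier_coef_def 4 5 rfact_of_nat f
      by (rule rearrange) (simp_all add: add_eq_0_iff)
  qed
  finally show ?thesis .
qed

definition weight_poly :: "nat \<Rightarrow> nat \<Rightarrow> nat \<Rightarrow> real poly" where
  "weight_poly N a b =
     (\<Sum>t\<le>min a b. Polynomial.smult (fourier_coef N a b (int t)) (chebU (a + b - 2 * t)))"

lemma weight_poly_commute: "weight_poly N a b = weight_poly N b a"
  by (simp add: weight_poly_def fourier_coef_commute[of N a b] min.commute add.commute)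

lemma weight_entry_eq:
  assumes "m \<le> n" "n \<le> N"
  shows "weight_entry N n m x = sqrt (1 - x\<^sup>2) * poly (weight_poly N n m) x"
  using assms
  by (simp add: weight_entry_def weight_poly_def poly_sum poly_chebU weight_coeff_eq min_def)

definition moment :: "nat \<Rightarrow> nat \<Rightarrow> nat \<Rightarrow> real poly \<Rightarrow> real" where
  "moment N a b p = semicircle (p * weight_poly N a b)"

lemma moment_add: "moment N a b (p + q) = moment N a b p + moment N a b q"
  and moment_diff: "moment N a b (p - q) = moment N a b p - moment N a b q"
  and moment_smult: "moment N a b (Polynomial.smult c p) = c * moment N a b p"
  by (simp_all add: moment_def semicircle_add semicircle_diff semicircle_smult algebra_simps)

text \<open>
  The coefficient of \<open>sin (k \<theta>)\<close> in the weight at \<open>x = cos \<theta>\<close>, for \<open>k > 0\<close>: the summation index is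
  \<open>t = (a + b + 1 - k) / 2\<close>. Its upper bound has to be imposed, while \<open>fourier_coef\<close> vanishes by
  itself for negative \<open>t\<close>.
\<close>
definition sine_coef :: "nat \<Rightarrow> nat \<Rightarrow> nat \<Rightarrow> int \<Rightarrow> real" where
  "sine_coef N a b k =
     (if even (int a + int b + 1 - k) \<and> (int a + int b + 1 - k) div 2 \<le> int (min a b)
      then fourier_coef N a b ((int a + int b + 1 - k) div 2) else 0)"

lemma sine_coef_eq:
  "sine_coef N a b (int a + int b + 1 - 2 * t) = (if t \<le> int (min a b) then fourier_coef N a b t else 0)"
  by (simp add: sine_coef_def)

lemma sine_coef_odd: "odd (int a + int b + 1 - k) \<Longrightarrow> sine_coef N a b k = 0"
  by (simp add: sine_coef_def)

lemma sine_coef_0 [simp]: "sine_coef N a b 0 = 0"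
  by (auto simp: sine_coef_def min_def)

text \<open>
  The moments against \<open>U\<^sub>k\<close> are Fourier coefficients, by the orthogonality of the \<open>U\<^sub>k\<close>. All
  properties of the weight that are needed below become statements on these numbers.
\<close>
lemma moment_chebU: "moment N a b (chebU k) = semicircle 1 * sine_coef N a b (int k + 1)"
proof -
  have m: "moment N a b (chebU k) =
      (\<Sum>t\<le>min a b. if k = a + b - 2 * t then semicircle 1 * fourier_coef N a b (int t) else 0)"
    unfolding moment_def weight_poly_def sum_distrib_left semicircle_sum
    by (rule sum.cong) (simp_all add: semicircle_smult semicircle_chebU_orthogonal)
  show ?thesis
  proof (cases "\<exists>t\<le>min a b. k + 2 * t = a + b")
    case True
    then obtain s where s: "s \<le> min a b" "k + 2 * s = a + b" by auto
    have "moment N a b (chebU k) =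
        (\<Sum>t\<le>min a b. if t = s then semicircle 1 * fourier_coef N a b (int t) else 0)"
      unfolding m by (rule sum.cong) (use s in auto)
    also have "\<dots> = semicircle 1 * fourier_coef N a b (int s)" using s by simp
    also have "int k + 1 = int a + int b + 1 - 2 * int s" using s by linarith
    then have "sine_coef N a b (int k + 1) = fourier_coef N a b (int s)"
      using s by (simp only: sine_coef_eq) simp
    then have "semicircle 1 * fourier_coef N a b (int s) = semicircle 1 * sine_coef N a b (int k + 1)"
      by simp
    finally show ?thesis .
  next
    case False
    have "sine_coef N a b (int k + 1) = 0"
    proof (rule ccontr)
      assume nz: "sine_coef N a b (int k + 1) \<noteq> 0"
      define t where "t = (int a + int b + 1 - (int k + 1)) div 2"
      have e: "even (int a + int b + 1 - (int k + 1))" and t: "t \<le> int (min a b)"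
        and f: "fourier_coef N a b t \<noteq> 0"
        using nz by (auto simp: sine_coef_def t_def split: if_splits)
      have "t \<ge> 0" using f fourier_coef_neg by force
      moreover have "2 * t = int a + int b - int k" using e by (simp add: t_def)
      ultimately have "nat t \<le> min a b" "k + 2 * nat t = a + b" using t by linarith+
      then show False using False by blast
    qed
    moreover have "moment N a b (chebU k) = 0"
      unfolding m by (rule sum.neutral) (use False in auto)
    ultimately show ?thesis by simp
  qed
qed

lemma moment_chebT:
  "moment N a b (chebT k) = (if k = 0 then semicircle 1 * sine_coef N a b 1 else
     semicircle 1 * (sine_coef N a b (int k + 1) - sine_coef N a b (int k - 1)) / 2)"
proof (cases k rule: chebT.cases)
  case 1
  then show ?thesis using moment_chebU[of N a b 0] by simp
next
  case 2
  have "chebT 1 = Polynomial.smult (1/2) (chebU 1)" by simp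
  then show ?thesis unfolding 2 by (simp del: chebU.simps chebT.simps add: moment_smult moment_chebU)
next
  case (3 n)
  show ?thesis unfolding 3 chebT_Suc_Suc moment_smult moment_diff moment_chebU
    by (simp add: algebra_simps)
qed

lemma moment_x_chebU:
  "moment N a b ([:0, 1:] * chebU k) =
     semicircle 1 * (sine_coef N a b (int k + 2) + sine_coef N a b (int k)) / 2"
proof (cases k)
  case 0
  have "[:0, 1:] * chebU 0 = Polynomial.smult (1/2) (chebU 1)" by simp
  then show ?thesis unfolding 0 by (simp del: chebU.simps chebT.simps add: moment_smult moment_chebU)
next
  case (Suc n)
  have "[:0, 1:] * chebU (Suc n) = Polynomial.smult (1/2) (chebU (Suc (Suc n)) + chebU n)" by simp
  then show ?thesis unfolding Suc
    by (simp del: chebU.simps chebT.simps add: moment_smult moment_add moment_chebU algebra_simps)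
qed

text \<open>
  After division by the common product of factorials this is
  \<open>(a + 1 - t) (N - a - b + t) + (b - t) (N + 1 - t) = (a + 1 + b - 2 t) (N - a)\<close>.
\<close>
lemma fourier_coef_lower:
  fixes a b N :: nat and t :: int
  assumes "Suc a \<le> N" "b \<le> N"
  defines "k \<equiv> int (Suc a) + int b - 2 * t"
  shows "of_int (k * int (Suc a)) * fourier_coef N a b t =
    of_int ((int (Suc a) - t) * (int (Suc a) + int b - t + 1)) * fourier_coef N (Suc a) b t
    + of_int ((int b - t) * (t + 1)) * fourier_coef N (Suc a) b (t + 1)"
proof -
  let ?A = "rfact t" and ?B = "rfact (int (Suc a) + int b - t)"
  let ?C = "rfact (int N + 1 - t)" and ?D = "rfact (int N - int a - int b + t)"
  let ?c = "(real N + 1)\<^sup>2 * (fact a * fact b * fact (N - Suc a) * fact (N - b))"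
  have Na: "N - a = Suc (N - Suc a)" using assms by simp
  have A: "?A = (of_int t + 1) * rfact (t + 1)"
    using rfact_diff_1[of "t + 1"] by simp
  have B: "?B = (real a + real b + 2 - of_int t) * rfact (int (Suc a) + int b + 1 - t)"
    using rfact_diff_1[of "int (Suc a) + int b + 1 - t"] by (simp add: algebra_simps)
  have C: "rfact (int N + 1 - (t + 1)) = (real N + 1 - of_int t) * ?C"
    using rfact_diff_1[of "int N + 1 - t"] by (simp add: algebra_simps)
  have D: "rfact (int N - int (Suc a) - int b + t) = (real N - real a - real b + of_int t) * ?D"
    using rfact_diff_1[of "int N - int a - int b + t"] by (simp add: algebra_simps)
  have 0: "fourier_coef N a b t = ?c * (real N - real a) * (?A * ?B * ?C * ?D)"
  proof -
    have "fact (N - a) = (real N - real a) * fact (N - Suc a)"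
      unfolding Na fact_Suc using assms by (simp add: of_nat_diff)
    moreover have "int a + int b + 1 - t = int (Suc a) + int b - t" by simp
    ultimately show ?thesis unfolding fourier_coef_def by (simp only: mult_ac)
  qed
  have fS: "fact (Suc a) = (real a + 1) * fact a" by (simp add: algebra_simps)
  have 1: "(real a + real b + 2 - of_int t) * fourier_coef N (Suc a) b t =
      ?c * (real a + 1) * (real N - real a - real b + of_int t) * (?A * ?B * ?C * ?D)"
    unfolding fourier_coef_def B D fS by (simp only: mult_ac)
  have 2: "(of_int t + 1) * fourier_coef N (Suc a) b (t + 1) =
      ?c * (real a + 1) * (real N + 1 - of_int t) * (?A * ?B * ?C * ?D)"
  proof -
    have e: "int (Suc a) + int b + 1 - (t + 1) = int (Suc a) + int b - t"
      "int N - int (Suc a) - int b + (t + 1) = int N - int a - int b + t" by simp_all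
    show ?thesis unfolding fourier_coef_def C e A fS by (simp only: mult_ac)
  qed
  have "of_int ((int (Suc a) - t) * (int (Suc a) + int b - t + 1)) * fourier_coef N (Suc a) b t
    + of_int ((int b - t) * (t + 1)) * fourier_coef N (Suc a) b (t + 1) =
    (real a + 1 - of_int t) * ((real a + real b + 2 - of_int t) * fourier_coef N (Suc a) b t)
    + (real b - of_int t) * ((of_int t + 1) * fourier_coef N (Suc a) b (t + 1))"
    by (simp add: algebra_simps)
  also have "\<dots> = (real a + 1 + real b - 2 * of_int t) * (real a + 1)
      * (?c * (real N - real a) * (?A * ?B * ?C * ?D))"
  proof -
    have "(real a + 1 - of_int t) * (c * (real a + 1) * (real N - real a - real b + of_int t) * z)
      + (real b - of_int t) * (c * (real a + 1) * (real N + 1 - of_int t) * z) =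
      (real a + 1 + real b - 2 * of_int t) * (real a + 1) * (c * (real N - real a) * z)" for c z
      by (simp add: algebra_simps)
    then show ?thesis unfolding 1 2 .
  qed
  also have "\<dots> = of_int (k * int (Suc a)) * fourier_coef N a b t"
    unfolding 0 k_def by simp (simp add: algebra_simps)
  finally show ?thesis ..
qed

text \<open>
  The Pearson equation of the weight for the second-order operator, in terms of Fourier
  coefficients. It survives the truncation at \<open>t = min a b\<close>, where \<open>k = a + b - 2 t\<close>: for
  \<open>t = b < a\<close> the factor \<open>k - a + b\<close> of the truncated term vanishes, and for \<open>t = a < b\<close> the factor
  \<open>k + a - b\<close> of the only term that is not truncated.
\<close>
lemma sine_coef_lower:
  assumes "a \<le> N" "b \<le> N"
  shows "4 * of_int k * real a * sine_coef N (a - 1) b k =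
    of_int ((k + int a - int b) * (k + int a + int b + 2)) * sine_coef N a b (k + 1)
    - of_int ((k - int a + int b) * (k - int a - int b - 2)) * sine_coef N a b (k - 1)"
proof (cases "even (int a + int b - k)")
  case False
  then have "sine_coef N (a - 1) b k = 0 \<or> a = 0" "sine_coef N a b (k + 1) = 0" "sine_coef N a b (k - 1) = 0"
    by (cases a; auto intro!: sine_coef_odd)+
  then show ?thesis by auto
next
  case True
  then obtain t where t: "k = int a + int b - 2 * t" by (metis dvdE diff_diff_eq2 diff_add_cancel add_diff_cancel_left' diff_eq_eq)
  have up: "sine_coef N a b (k + 1) = (if t \<le> int (min a b) then fourier_coef N a b t else 0)"
    using sine_coef_eq[of N a b t] by (simp add: t algebra_simps)
  have down: "sine_coef N a b (k - 1) = (if t + 1 \<le> int (min a b) then fourier_coef N a b (t + 1) else 0)"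
    using sine_coef_eq[of N a b "t + 1"] by (simp add: t algebra_simps)
  have fac: "(k + int a - int b) * (k + int a + int b + 2) = 4 * ((int a - t) * (int a + int b - t + 1))"
     "(k - int a + int b) * (k - int a - int b - 2) = - 4 * ((int b - t) * (t + 1))"
    unfolding t by (simp_all add: algebra_simps)
  have "of_int k * real a * sine_coef N (a - 1) b k =
    of_int ((int a - t) * (int a + int b - t + 1)) * sine_coef N a b (k + 1)
    + of_int ((int b - t) * (t + 1)) * sine_coef N a b (k - 1)"
  proof (cases a)
    case 0
    then show ?thesis unfolding up down
      by (cases "t < 0"; cases "t = 0"; cases "t = -1") (simp_all add: fourier_coef_neg)
  next
    case (Suc c)
    have mid: "sine_coef N (a - 1) b k = (if t \<le> int (min c b) then fourier_coef N c b t else 0)"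
      using sine_coef_eq[of N c b t] by (simp add: Suc t algebra_simps)
    have key: "of_int k * real a * fourier_coef N c b t =
        of_int ((int a - t) * (int a + int b - t + 1)) * fourier_coef N a b t
        + of_int ((int b - t) * (t + 1)) * fourier_coef N a b (t + 1)"
      using fourier_coef_lower[of c N b t] assms unfolding t Suc by simp
    \<comment> \<open>Inside the support, on its upper boundary, and beyond it.\<close>
    consider "t + 1 \<le> int (min a b)" | "t = int b" "b < a" | "t = int a" "a < b" | "t = int a" "a = b"
      | "t > int (min a b)" by linarith
    then show ?thesis
    proof cases
      case 1
      then show ?thesis unfolding up down mid using key Suc by simp
    next
      case 2
      then show ?thesis unfolding up down mid using key Suc by simp
    next
      case 3
      then show ?thesis unfolding up down mid using Suc by simp
    next
      case 4
      then show ?thesis unfolding up down mid using t by simp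
    next
      case 5
      then show ?thesis unfolding up down mid using Suc by auto
    qed
  qed
  then show ?thesis unfolding fac by simp
qed

lemma sine_coef_1:
  assumes "a \<noteq> b"
  shows "sine_coef N a b 1 = 0"
proof (cases "even (int a + int b)")
  case True
  then obtain t where t: "int a + int b = 2 * t" by (rule evenE)
  then have "1 = int a + int b + 1 - 2 * t" by simp
  moreover have "\<not> t \<le> int (min a b)" using t assms by (simp add: min_def)
  ultimately show ?thesis by (metis sine_coef_eq)
qed (simp add: sine_coef_odd)

text \<open>
  The entrywise form of the symmetry of the second-order operator with respect to the
  weight. It is linear in \<open>p\<close> and is tested on the \<open>T\<^sub>k\<close> rather than on the \<open>U\<^sub>k\<close>: as
  \<open>T\<^sub>k' = k U\<^sub>k\<^sub>-\<^sub>1\<close> and \<open>(1 - x\<^sup>2) T\<^sub>k'' = x T\<^sub>k' - k\<^sup>2 T\<^sub>k\<close>, only three neighbouring Fourier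
  coefficients occur, and they are related by the preceding lemmas.
\<close>
lemma moment_operator:
  assumes "a \<le> N" "b \<le> N"
  shows "moment N a b ([:1, 0, -1:] * pderiv (pderiv p) - Polynomial.smult (2 * real a + 3) ([:0, 1:] * pderiv p))
    + 2 * real a * moment N (a - 1) b (pderiv p)
    = ((real a + 1)\<^sup>2 - (real b + 1)\<^sup>2) * moment N a b p"
proof (induction p rule: cheb_span_induct)
  case (1 k)
  show ?case
  proof (cases k)
    case 0
    show ?thesis
    proof (cases "a = b")
      case False
      then show ?thesis
        unfolding 0 moment_chebT by (simp add: sine_coef_1 moment_def)
    qed (simp add: 0 moment_def)
  next
    case (Suc m)
    have d: "pderiv (chebT (Suc m)) = Polynomial.smult (real m + 1) (chebU m)"
      by (rule iffD1[OF poly_eq_poly_eq_iff], rule ext) (simp add: pderiv_chebT)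
    have "[:1, 0, -1:] * pderiv (chebU m) = [:0, 1:] * chebU m - Polynomial.smult (real m + 1) (chebT (Suc m))"
      (is "?l = ?r")
    proof (rule iffD1[OF poly_eq_poly_eq_iff], rule ext)
      fix x
      show "poly ?l x = poly ?r x"
        using pderiv_chebU[of x m] by (simp add: algebra_simps power2_eq_square del: chebT.simps)
    qed
    then have e: "[:1, 0, -1:] * pderiv (pderiv (chebT (Suc m)))
        - Polynomial.smult (2 * real a + 3) ([:0, 1:] * pderiv (chebT (Suc m))) =
        Polynomial.smult (real m + 1) ([:0, 1:] * chebU m - Polynomial.smult (real m + 1) (chebT (Suc m))
          - Polynomial.smult (2 * real a + 3) ([:0, 1:] * chebU m))"
      unfolding d pderiv_smult by (simp add: smult_diff_right mult.commute del: chebT.simps mult_pCons_left)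
    define g where "g = sine_coef N a b (int m + 2)"
    define h where "h = sine_coef N a b (int m)"
    define c where "c = semicircle 1"
    have k: "4 * (real m + 1) * real a * sine_coef N (a - 1) b (int m + 1) =
      ((real m + 1 + real a - real b) * (real m + 1 + real a + real b + 2)) * g
      - ((real m + 1 - real a + real b) * (real m + 1 - real a - real b - 2)) * h"
      using sine_coef_lower[OF assms, of "int m + 1"] by (simp add: g_def h_def algebra_simps)
    have T: "moment N a b (chebT (Suc m)) = c * (g - h) / 2"
      unfolding moment_chebT by (simp add: g_def h_def c_def algebra_simps)
    have xU: "moment N a b ([:0, 1:] * chebU m) = c * (g + h) / 2"
      unfolding moment_x_chebU by (simp add: g_def h_def c_def)
    have "2 * real a * moment N (a - 1) b (pderiv (chebT (Suc m))) =
      c / 2 * (4 * (real m + 1) * real a * sine_coef N (a - 1) b (int m + 1))"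
      unfolding d moment_smult moment_chebU c_def by simp
    then show ?thesis
      unfolding Suc e moment_smult moment_diff xU T k
      by (simp add: field_simps power2_eq_square)
  qed
next
  case (2 p q)
  then show ?case
    by (simp only: pderiv_add distrib_left smult_add_right moment_add moment_diff)
next
  case (3 c p)
  have e: "[:1, 0, -1:] * pderiv (pderiv (Polynomial.smult c p))
      - Polynomial.smult (2 * real a + 3) ([:0, 1:] * pderiv (Polynomial.smult c p)) =
      Polynomial.smult c ([:1, 0, -1:] * pderiv (pderiv p) - Polynomial.smult (2 * real a + 3) ([:0, 1:] * pderiv p))"
    by (simp only: pderiv_smult mult_smult_right smult_diff_right smult_smult mult.commute[of c])
  have scale: "c * A + k * (c * B) = K * (c * M)" if "A + k * B = K * M" for A B k K M :: real
    using arg_cong[OF that, of "\<lambda>z. c * z"] by (simp add: algebra_simps)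
  show ?case unfolding e unfolding pderiv_smult moment_smult by (rule scale) (rule 3)
qed

lemma sine_coef_reflect:
  assumes "a \<le> N" "b \<le> N"
  shows "sine_coef N (N - a) (N - b) k = sine_coef N a b k"
proof (cases "even (int a + int b + 1 - k)")
  case True
  then obtain t where t: "int a + int b + 1 - k = 2 * t" by (rule evenE)
  then have k: "k = int a + int b + 1 - 2 * t" by simp
  have k': "k = int (N - a) + int (N - b) + 1 - 2 * (int N - int a - int b + t)"
    using k assms by (simp add: of_nat_diff)
  have "sine_coef N (N - a) (N - b) k =
      (if t \<le> int (min a b) then fourier_coef N a b t else 0)"
    unfolding k' sine_coef_eq fourier_coef_reflect[OF assms]
    using assms by (auto simp: min_def)
  also have "\<dots> = sine_coef N a b k" unfolding k sine_coef_eq ..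
  finally show ?thesis .
next
  case False
  then show ?thesis using assms by (auto intro!: sine_coef_odd simp: sine_coef_odd of_nat_diff)
qed

lemma moment_reflect:
  assumes "a \<le> N" "b \<le> N"
  shows "moment N (N - a) (N - b) p = moment N a b p"
  by (induction p rule: cheb_span_induct)
    (simp_all add: moment_chebT sine_coef_reflect[OF assms] moment_add moment_smult)

lemma moment_1_diag_nonzero:
  assumes "a \<le> N"
  shows "moment N a a 1 \<noteq> 0"
proof -
  have "sine_coef N a a 1 = fourier_coef N a a (int a)"
    using sine_coef_eq[of N a a "int a"] by simp
  also have "\<dots> \<noteq> 0" using assms by (simp add: fourier_coef_def rfact_def add_eq_0_iff)
  finally show ?thesis
    using moment_chebU[of N a a 0] semicircle_1_nonzero by simp
qed

section \<open>Orthogonality of the rows\<close>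

text \<open>
  Entry \<open>b\<close> of the integral of the row \<open>r\<close> times the weight.
\<close>
definition column_moment :: "nat \<Rightarrow> nat \<Rightarrow> (nat \<Rightarrow> real poly) \<Rightarrow> real" where
  "column_moment N b r = (\<Sum>a\<le>N. moment N a b (r a))"

text \<open>
  The second-order operator is symmetric for the weight and acts on the constant row \<open>b\<close> by
  the scalar \<open>- (b + 1)\<^sup>2\<close>. The off-diagonal terms cancel after a shift of the summation index,
  for which the entry \<open>r (N + 1)\<close> has to vanish.
\<close>
lemma column_moment_operator:
  assumes "b \<le> N" and "r (Suc N) = 0"
  shows "column_moment N b (\<lambda>a. [:1, 0, -1:] * pderiv (pderiv (r a))
      - Polynomial.smult (2 * real a + 3) ([:0, 1:] * pderiv (r a))
      + Polynomial.smult (2 * (real a + 1)) (pderiv (r (Suc a)))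
      - Polynomial.smult ((real a + 1)\<^sup>2) (r a)) =
    - (real b + 1)\<^sup>2 * column_moment N b r"
proof -
  define h where "h = (\<lambda>a. 2 * real a * moment N (a - 1) b (pderiv (r a)))"
  have "(\<Sum>a\<le>N. h (Suc a)) = (\<Sum>a\<le>Suc N. h a)"
    unfolding sum.atMost_Suc_shift[of h N] by (simp add: h_def)
  also have "\<dots> = (\<Sum>a\<le>N. h a)" using assms(2) by (simp add: h_def moment_def)
  finally have shift: "(\<Sum>a\<le>N. h (Suc a)) = (\<Sum>a\<le>N. h a)" .
  have "column_moment N b (\<lambda>a. [:1, 0, -1:] * pderiv (pderiv (r a))
      - Polynomial.smult (2 * real a + 3) ([:0, 1:] * pderiv (r a))
      + Polynomial.smult (2 * (real a + 1)) (pderiv (r (Suc a)))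
      - Polynomial.smult ((real a + 1)\<^sup>2) (r a)) =
    (\<Sum>a\<le>N. - (real b + 1)\<^sup>2 * moment N a b (r a) + (h (Suc a) - h a))"
    unfolding column_moment_def
  proof (rule sum.cong)
    fix a assume "a \<in> {..N}"
    then have "a \<le> N" by simp
    from moment_operator[OF this assms(1), of "r a"]
    show "moment N a b ([:1, 0, -1:] * pderiv (pderiv (r a))
        - Polynomial.smult (2 * real a + 3) ([:0, 1:] * pderiv (r a))
        + Polynomial.smult (2 * (real a + 1)) (pderiv (r (Suc a)))
        - Polynomial.smult ((real a + 1)\<^sup>2) (r a)) =
      - (real b + 1)\<^sup>2 * moment N a b (r a) + (h (Suc a) - h a)"
      unfolding moment_diff[of _ _ _ _ "Polynomial.smult ((real a + 1)\<^sup>2) (r a)"] moment_add moment_smult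
      by (simp add: h_def algebra_simps)
  qed simp
  also have "\<dots> = - (real b + 1)\<^sup>2 * column_moment N b r"
    unfolding sum.distrib sum_subtractf shift column_moment_def sum_distrib_left by simp
  finally show ?thesis .
qed

lemma column_moment_smult:
  "column_moment N b (\<lambda>a. Polynomial.smult c (r a)) = c * column_moment N b r"
  by (simp add: column_moment_def moment_smult sum_distrib_left)

text \<open>
  Eigenvectors of a symmetric operator for different eigenvalues \<open>- (n + i + 1)\<^sup>2\<close> and
  \<open>- (b + 1)\<^sup>2\<close> are orthogonal.
\<close>
lemma column_moment_spherical_off:
  assumes "i \<le> N" "b \<le> N" "b \<noteq> n + i"
  shows "column_moment N b (spherical N n i) = 0"
proof -
  have "[:1, 0, -1:] * pderiv (pderiv (spherical N n i a))
      - Polynomial.smult (2 * real a + 3) ([:0, 1:] * pderiv (spherical N n i a))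
      + Polynomial.smult (2 * (real a + 1)) (pderiv (spherical N n i (Suc a)))
      - Polynomial.smult ((real a + 1)\<^sup>2) (spherical N n i a) =
      Polynomial.smult (- (lidx n i)\<^sup>2) (spherical N n i a)" (is "?l = ?r") for a
  proof (rule iffD1[OF poly_eq_poly_eq_iff], rule ext)
    fix x show "poly ?l x = poly ?r x"
      using spherical_second_order[OF assms(1), of x n a] by (simp add: algebra_simps power2_eq_square)
  qed
  then have "- (lidx n i)\<^sup>2 * column_moment N b (spherical N n i) = - (real b + 1)\<^sup>2 * column_moment N b (spherical N n i)"
    using column_moment_operator[OF assms(2), of "spherical N n i"] spherical_column_out_of_range[OF assms(1)]
    by (simp only: column_moment_smult lessI)
  moreover have "(lidx n i)\<^sup>2 \<noteq> (real b + 1)\<^sup>2"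
  proof
    assume "(lidx n i)\<^sup>2 = (real b + 1)\<^sup>2"
    then have "lidx n i = real b + 1" by (simp add: power2_eq_iff_nonneg)
    then show False using assms(3) by (simp add: of_nat_add[symmetric] del: of_nat_add)
  qed
  ultimately show ?thesis by simp
qed

lemma column_moment_spherical_reflect:
  assumes "i \<le> N" "b \<le> N"
  shows "column_moment N (N - b) (spherical N n (N - i)) = column_moment N b (spherical N n i)"
proof -
  have "moment N a (N - b) (spherical N n (N - i) a) = moment N (N - a) b (spherical N n i (N - a))"
    if "a \<le> N" for a
    using moment_reflect[of "N - a" N b] spherical_reflect[of i N "N - a" n] that assms by simp
  then show ?thesis
    unfolding column_moment_def
    by (intro sum.reindex_bij_witness[of _ "\<lambda>a. N - a" "\<lambda>a. N - a"]) auto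
qed

text \<open>
  By the left dimension the integral vanishes unless \<open>b = n + i\<close>, by the reflected argument
  for the right dimension unless \<open>N - b = n + N - i\<close>; both hold only for \<open>n = 0\<close>.
\<close>
lemma column_moment_spherical:
  assumes "i \<le> N" "b \<le> N"
  shows "column_moment N b (spherical N n i) = (if n = 0 \<and> b = i then moment N i i 1 else 0)"
proof (cases "n = 0 \<and> b = i")
  case True
  have "moment N a i (if i = a then 1 else 0) = (if a = i then moment N i i 1 else 0)" for a
    by (simp add: moment_def)
  then show ?thesis using True assms by (simp add: column_moment_def)
next
  case False
  then have "b \<noteq> n + i \<or> N - b \<noteq> n + (N - i)" using assms by auto
  then show ?thesis
    using column_moment_spherical_off[OF assms, of n] column_moment_spherical_off[of "N - i" N "N - b" n]
      column_moment_spherical_reflect[OF assms, of n] False by auto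
qed

definition row_pairing :: "nat \<Rightarrow> (nat \<Rightarrow> real poly) \<Rightarrow> (nat \<Rightarrow> real poly) \<Rightarrow> real" where
  "row_pairing N r s = (\<Sum>a\<le>N. \<Sum>b\<le>N. moment N a b (r a * s b))"

lemma moment_commute: "moment N a b p = moment N b a p"
  by (simp add: moment_def weight_poly_commute)

lemma row_pairing_commute: "row_pairing N r s = row_pairing N s r"
  unfolding row_pairing_def
  by (subst sum.swap) (simp add: moment_commute[of N _ _] mult.commute)

lemma row_pairing_add_left:
    "row_pairing N (\<lambda>a. r a + r' a) s = row_pairing N r s + row_pairing N r' s"
  and row_pairing_diff_left:
    "row_pairing N (\<lambda>a. r a - r' a) s = row_pairing N r s - row_pairing N r' s"
  and row_pairing_smult_left:
    "row_pairing N (\<lambda>a. Polynomial.smult c (r a)) s = c * row_pairing N r s"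
  by (simp_all add: row_pairing_def distrib_right left_diff_distrib moment_add moment_diff
      moment_smult sum.distrib sum_subtractf sum_distrib_left)

lemma row_pairing_sum_left:
  "row_pairing N (\<lambda>a. \<Sum>k\<in>K. r k a) s = (\<Sum>k\<in>K. row_pairing N (r k) s)"
proof (induction K rule: infinite_finite_induct)
  case (insert k K)
  then show ?case by (simp add: row_pairing_add_left)
qed (simp_all add: row_pairing_def moment_def)

lemma row_pairing_x:
  "row_pairing N (\<lambda>a. pCons 0 (r a)) s = row_pairing N r (\<lambda>a. pCons 0 (s a))"
  by (simp add: row_pairing_def)

text \<open>
  The Gram matrix of the rows, and that of multiplication by \<open>x\<close>. Both are symmetric, and the
  recurrence expresses the second through the first in either pair of indices.
\<close>
definition gram :: "nat \<Rightarrow> nat \<Rightarrow> nat \<Rightarrow> nat \<Rightarrow> nat \<Rightarrow> real" where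
  "gram N n i m k = row_pairing N (spherical N n i) (spherical N m k)"

definition gram_x :: "nat \<Rightarrow> nat \<Rightarrow> nat \<Rightarrow> nat \<Rightarrow> nat \<Rightarrow> real" where
  "gram_x N n i m k = row_pairing N (\<lambda>a. pCons 0 (spherical N n i a)) (spherical N m k)"

lemma gram_commute: "gram N n i m k = gram N m k n i"
  by (simp add: gram_def row_pairing_commute)

lemma gram_x_commute: "gram_x N n i m k = gram_x N m k n i"
  unfolding gram_x_def by (subst row_pairing_commute) (rule row_pairing_x[symmetric])

lemma gram_x_eq:
  "2 * lidx n i * ridx N n i * gram_x N n i m k =
    vert_coef N (Suc n) * gram N (Suc n) i m k + vert_coef N n * gram N (n - 1) i m k
    + horiz_coef N (Suc i) * gram N n (Suc i) m k + horiz_coef N i * gram N n (i - 1) m k"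
  unfolding gram_x_def gram_def row_pairing_smult_left[symmetric] row_pairing_add_left[symmetric]
  by (simp only: spherical_recurrence)

lemma gram_0:
  assumes "i \<le> N" "k \<le> N"
  shows "gram N n i 0 k = (if n = 0 \<and> k = i then moment N i i 1 else 0)"
proof -
  have "(\<Sum>b\<le>N. moment N a b (spherical N n i a * spherical N 0 k b)) = moment N a k (spherical N n i a)" for a
  proof -
    have "moment N a b (spherical N n i a * spherical N 0 k b) = (if b = k then moment N a k (spherical N n i a) else 0)" for b
      by (simp add: moment_def)
    then show ?thesis using assms by simp
  qed
  then show ?thesis
    using column_moment_spherical[OF assms, of n] unfolding gram_def row_pairing_def column_moment_def by simp
qed

lemma horiz_mult_zero:
  assumes "\<And>i. i \<le> N \<Longrightarrow> f i = 0" and "i \<le> N"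
  shows "horiz_coef N (Suc i) * f (Suc i) = 0" "horiz_coef N i * f (i - 1) = 0"
  using assms by (cases "i = N"; simp)+

text \<open>
  The argument of Favard's theorem: multiplication by \<open>x\<close> is moved from the right to the left
  entry, which decreases \<open>m\<close> at the cost of decreasing \<open>n\<close> by at most one, until \<open>m = 0\<close>.
\<close>
lemma gram_upper:
  "m < n \<Longrightarrow> i \<le> N \<Longrightarrow> k \<le> N \<Longrightarrow> gram N n i m k = 0"
proof (induction m arbitrary: n i k rule: less_induct)
  case (less m)
  show ?case
  proof (cases m)
    case 0
    then show ?thesis using less.prems gram_0 by simp
  next
    case (Suc l)
    have z: "gram N n' i' l' k' = 0" if "i' \<le> N" "k' \<le> N" "l' \<le> l" "l' < n'" for n' i' l' k'
      using less.IH[of l' n' i' k'] that Suc by simp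
    have "2 * lidx n i * ridx N n i * gram_x N n i l k = 0"
      unfolding gram_x_eq
      using z[of i k l "Suc n"] z[of i k l "n - 1"] less.prems Suc
        horiz_mult_zero[of N "\<lambda>i. gram N n i l k" i] z[of _ k l n] by simp
    then have "gram_x N n i l k = 0" using less.prems by simp
    then have "gram_x N l k n i = 0" by (simp add: gram_x_commute)
    moreover have "gram N (l - 1) k n i = 0"
      using z[of i k "l - 1" n] less.prems Suc unfolding gram_commute[of N "l - 1"] by simp
    moreover have "horiz_coef N (Suc k) * gram N l (Suc k) n i = 0" "horiz_coef N k * gram N l (k - 1) n i = 0"
      using horiz_mult_zero[of N "\<lambda>k. gram N l k n i" k] z[of i _ l n] less.prems Suc
      by (simp_all add: gram_commute[of N l])
    ultimately have "vert_coef N (Suc l) * gram N (Suc l) k n i = 0"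
      using gram_x_eq[of l k N n i] by (simp only: mult_zero_right add_0_right)
    then show ?thesis using vert_coef_Suc_pos[of N l] Suc
      by (simp add: gram_commute[of N n])
  qed
qed

text \<open>
  Moving one factor \<open>x\<close> across relates the norms for \<open>n + 1\<close> to those for \<open>n\<close> by a nonzero
  factor, and the norms for \<open>n = 0\<close> are nonzero multiples of the coefficients of \<open>U\<^sub>0\<close> in the
  diagonal entries of the weight.
\<close>
lemma gram_diag:
  "i \<le> N \<Longrightarrow> k \<le> N \<Longrightarrow> (gram N n i n k = 0) = (i \<noteq> k)"
proof (induction n arbitrary: i k)
  case 0
  then show ?case by (simp add: gram_0 moment_1_diag_nonzero)
next
  case (Suc n)
  have z: "gram N n' i' l' k' = 0" if "i' \<le> N" "k' \<le> N" "l' < n'" for n' i' l' k'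
    using gram_upper that by simp
  have "2 * lidx (Suc n) i * ridx N (Suc n) i * gram_x N (Suc n) i n k = vert_coef N (Suc n) * gram N n i n k"
    unfolding gram_x_eq
    using z[of i k n "Suc (Suc n)"] Suc.prems
      horiz_mult_zero[of N "\<lambda>i. gram N (Suc n) i n k" i] z[of _ k n "Suc n"] by simp
  moreover have "lidx (Suc n) i \<noteq> 0" "ridx N (Suc n) i \<noteq> 0" using Suc.prems by simp_all
  ultimately have "(gram_x N (Suc n) i n k = 0) = (i \<noteq> k)"
    using Suc vert_coef_Suc_pos[of N n] by (metis less_irrefl mult_eq_0_iff zero_neq_numeral)
  moreover have "2 * lidx n k * ridx N n k * gram_x N n k (Suc n) i = vert_coef N (Suc n) * gram N (Suc n) k (Suc n) i"
    unfolding gram_x_eq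
    using z[of i k "n - 1" "Suc n"] Suc.prems
      horiz_mult_zero[of N "\<lambda>k. gram N (Suc n) i n k" k] z[of i _ n "Suc n"]
    unfolding gram_commute[of N n] gram_commute[of N "n - 1"] by simp
  moreover have "lidx n k \<noteq> 0" "ridx N n k \<noteq> 0" using Suc.prems by simp_all
  ultimately show ?case
    using vert_coef_Suc_pos[of N n]
    by (metis less_irrefl mult_eq_0_iff zero_neq_numeral gram_commute gram_x_commute)
qed

lemma monic_factor_pos: "i \<le> N \<Longrightarrow> monic_factor N n i > 0"
  unfolding monic_factor_def by (rule prod_pos) simp

text \<open>
  The rows with labels \<open>(m, k)\<close>, \<open>m < n\<close>, form an orthogonal basis of the rows of degree less
  than \<open>n\<close>, and no basis vector has norm zero.
\<close>
lemma row_pairing_nondegenerate: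
  "(\<And>a k. a \<le> N \<Longrightarrow> n \<le> k \<Longrightarrow> coeff (d a) k = 0) \<Longrightarrow>
   (\<And>m k. m < n \<Longrightarrow> k \<le> N \<Longrightarrow> row_pairing N d (spherical N m k) = 0) \<Longrightarrow> a \<le> N \<Longrightarrow> d a = 0"
proof (induction n arbitrary: d a)
  case 0
  then show ?case by (simp add: poly_eq_iff)
next
  case (Suc n)
  \<comment> \<open>The leading coefficients of \<open>d\<close> in the basis of the rows \<open>(n, k)\<close>.\<close>
  define c where "c = (\<lambda>k. coeff (d k) n * monic_factor N n k)"
  define e where "e = (\<lambda>a. d a - (\<Sum>k\<le>N. Polynomial.smult (c k) (spherical N n k a)))"
  have pair: "row_pairing N e s = row_pairing N d s - (\<Sum>k\<le>N. c k * row_pairing N (spherical N n k) s)" for s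
    unfolding e_def row_pairing_diff_left row_pairing_sum_left row_pairing_smult_left ..
  have e: "e a = 0" if a: "a \<le> N" for a
  proof (rule Suc.IH[OF _ _ a])
    fix a k assume a: "a \<le> N" and k: "n \<le> k"
    have "(\<Sum>j\<le>N. c j * coeff (spherical N n j a) k) = (\<Sum>j\<le>N. if j = a then (if k = n then coeff (d a) n else 0) else 0)"
    proof (rule sum.cong)
      fix j assume "j \<in> {..N}"
      then show "c j * coeff (spherical N n j a) k = (if j = a then (if k = n then coeff (d a) n else 0) else 0)"
        using k monic_factor_pos[of j N n] by (auto simp add: coeff_spherical c_def)
    qed simp
    also have "\<dots> = coeff (d a) k" using a k Suc.prems(1)[of a k] by auto
    finally show "coeff (e a) k = 0" by (simp add: e_def coeff_sum)
  next
    fix m k assume "m < n" "k \<le> N"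
    then show "row_pairing N e (spherical N m k) = 0"
      unfolding pair using Suc.prems(2)[of m k] gram_upper[of m n _ N k]
      by (simp add: gram_def)
  qed
  have "c k = 0" if k: "k \<le> N" for k
  proof -
    have "row_pairing N e (spherical N n k) = 0"
      unfolding row_pairing_def using e by (simp add: moment_def)
    then have "0 = (\<Sum>j\<le>N. c j * gram N n j n k)"
      unfolding pair using Suc.prems(2)[of n k] k by (simp add: gram_def)
    also have "\<dots> = (\<Sum>j\<le>N. if j = k then c k * gram N n k n k else 0)"
      by (rule sum.cong) (use gram_diag k in auto)
    finally show ?thesis using k gram_diag[of k N k n] by simp
  qed
  then have "d a = e a" using Suc.prems(3) by (simp add: e_def)
  then show ?case using e Suc.prems(3) by simp
qed

section \<open>Uniqueness and the recurrence relation\<close>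

abbreviation complex_poly :: "real poly \<Rightarrow> complex poly" where
  "complex_poly \<equiv> map_poly complex_of_real"

lemma poly_complex_poly_of_real: "poly (complex_poly q) (complex_of_real x) = complex_of_real (poly q x)"
  by (induction q) (simp_all add: map_poly_pCons)

lemma complex_poly_add: "complex_poly (p + q) = complex_poly p + complex_poly q"
  and complex_poly_smult: "complex_poly (Polynomial.smult c p) = Polynomial.smult (complex_of_real c) (complex_poly p)"
  and complex_poly_pCons: "complex_poly (pCons c p) = pCons (complex_of_real c) (complex_poly p)"
  by (simp_all add: poly_eq_iff coeff_map_poly coeff_pCons split: nat.splits)

lemma Re_poly_of_real: "Re (poly p (complex_of_real x)) = poly (map_poly Re p) x"
  and Im_poly_of_real: "Im (poly p (complex_of_real x)) = poly (map_poly Im p) x"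
  by (induction p) (simp_all add: map_poly_pCons)

lemma weight_index:
  assumes "a \<le> N" "b \<le> N"
  shows "weight N x $$ (a, b) = complex_of_real (sqrt (1 - x\<^sup>2) * poly (weight_poly N a b) x)"
  using assms weight_entry_eq[of b a N x] weight_entry_eq[of a b N x]
  by (simp add: weight_def weight_poly_commute[of N a b])

lemma mat_adjoint_index:
  assumes "B \<in> carrier_mat n n" "i < n" "j < n"
  shows "mat_adjoint B $$ (i, j) = conjugate (B $$ (j, i))"
  using assms by (simp add: mat_adjoint_def mat_of_rows_def)

lemma triple_product_index:
  assumes "A \<in> carrier_mat n n" "W \<in> carrier_mat n n" "B \<in> carrier_mat n n" "i < n" "k < n"
  shows "(A * W * B) $$ (i, k) = (\<Sum>c<n. \<Sum>b<n. A $$ (i, b) * W $$ (b, c) * B $$ (c, k))"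
  using assms by (simp add: scalar_prod_def sum_distrib_left mult.assoc atLeast0LessThan) (rule sum.swap)

lemma integral_complex_split:
  fixes g h :: "real \<Rightarrow> real"
  assumes "g integrable_on S" "h integrable_on S"
  shows "integral S (\<lambda>x. Complex (g x) (h x)) = Complex (integral S g) (integral S h)"
proof -
  have "((\<lambda>x. complex_of_real (g x) + \<i> * complex_of_real (h x)) has_integral
      (complex_of_real (integral S g) + \<i> * complex_of_real (integral S h))) S"
    using assms by (intro has_integral_add has_integral_mult_right has_integral_of_real integrable_integral)
  then show ?thesis by (simp add: Complex_eq integral_unique)
qed

text \<open>
  If the second argument is real, the real and the imaginary part of the pairing are real
  pairings, so that the complex problem splits into two real ones.
\<close>
lemma weight_pairing_index:
  assumes P: "P \<in> carrier_mat (N + 1) (N + 1)" and Q: "Q \<in> carrier_mat (N + 1) (N + 1)"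
    and i: "i \<le> N" and k: "k \<le> N"
    and q: "\<And>b. b \<le> N \<Longrightarrow> Q $$ (k, b) = complex_poly (q b)"
  shows "weight_pairing N P Q $$ (i, k) =
    Complex (row_pairing N (\<lambda>a. map_poly Re (P $$ (i, a))) q) (row_pairing N (\<lambda>a. map_poly Im (P $$ (i, a))) q)"
proof -
  define G where "G = (\<lambda>f :: complex \<Rightarrow> real. \<Sum>c\<le>N. \<Sum>b\<le>N. map_poly f (P $$ (i, b)) * q c * weight_poly N b c)"
  have G: "semicircle (G f) = row_pairing N (\<lambda>a. map_poly f (P $$ (i, a))) q" for f
    unfolding G_def row_pairing_def semicircle_sum moment_def by (rule sum.swap)
  have entry: "(mpoly_eval P (of_real x) * weight N x * mat_adjoint (mpoly_eval Q (of_real x))) $$ (i, k) =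
      Complex (sqrt (1 - x\<^sup>2) * poly (G Re) x) (sqrt (1 - x\<^sup>2) * poly (G Im) x)" for x :: real
  proof -
    let ?s = "sqrt (1 - x\<^sup>2)"
    have c1: "mpoly_eval P (of_real x) \<in> carrier_mat (N + 1) (N + 1)"
      "mpoly_eval Q (of_real x) \<in> carrier_mat (N + 1) (N + 1)"
      using P Q by (simp_all add: mpoly_eval_def)
    have c2: "weight N x \<in> carrier_mat (N + 1) (N + 1)" by (simp add: weight_def)
    have c3: "mat_adjoint (mpoly_eval Q (of_real x)) \<in> carrier_mat (N + 1) (N + 1)"
      using c1(2) by (auto simp: mat_adjoint_def mat_of_rows_def)
    have adj: "mat_adjoint (mpoly_eval Q (of_real x)) $$ (c, k) = complex_of_real (poly (q c) x)"
      if "c \<le> N" for c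
      using mat_adjoint_index[OF c1(2), of c k] that k Q q[OF that]
      by (simp add: mpoly_eval_def poly_complex_poly_of_real)
    have "(mpoly_eval P (of_real x) * weight N x * mat_adjoint (mpoly_eval Q (of_real x))) $$ (i, k) =
      (\<Sum>c<N + 1. \<Sum>b<N + 1. mpoly_eval P (of_real x) $$ (i, b) * weight N x $$ (b, c)
        * mat_adjoint (mpoly_eval Q (of_real x)) $$ (c, k))"
      by (rule triple_product_index[OF c1(1) c2 c3]) (use i k in simp_all)
    also have "\<dots> = (\<Sum>c<N + 1. \<Sum>b<N + 1. poly (P $$ (i, b)) (of_real x) * weight N x $$ (b, c)
        * complex_of_real (poly (q c) x))"
    proof -
      have "mpoly_eval P (of_real x) $$ (i, b) = poly (P $$ (i, b)) (of_real x)" if "b \<le> N" for b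
        using that i P by (simp add: mpoly_eval_def)
      then show ?thesis by (intro sum.cong) (auto simp: adj)
    qed
    also have "\<dots> = (\<Sum>c\<le>N. \<Sum>b\<le>N. poly (P $$ (i, b)) (of_real x)
        * complex_of_real (?s * poly (weight_poly N b c) x) * complex_of_real (poly (q c) x))"
      by (intro sum.cong) (auto simp: weight_index)
    also have "\<dots> = Complex (?s * poly (G Re) x) (?s * poly (G Im) x)"
      by (simp add: complex_eq_iff Re_poly_of_real Im_poly_of_real G_def poly_sum sum_distrib_left
          mult_ac del: of_real_mult)
    finally show ?thesis .
  qed
  have "weight_pairing N P Q $$ (i, k) =
      integral {-1..1} (\<lambda>x. Complex (sqrt (1 - x\<^sup>2) * poly (G Re) x) (sqrt (1 - x\<^sup>2) * poly (G Im) x))"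
    using i k by (simp add: weight_pairing_def mat_integral_def entry)
  also have "\<dots> = Complex (semicircle (G Re)) (semicircle (G Im))"
    unfolding semicircle_def by (rule integral_complex_split) (rule semicircle_integrable)+
  finally show ?thesis unfolding G .
qed

definition monic_spherical :: "nat \<Rightarrow> nat \<Rightarrow> nat \<Rightarrow> nat \<Rightarrow> real poly" where
  "monic_spherical N n i j = Polynomial.smult (monic_factor N n i) (spherical N n i j)"

text \<open>
  By induction \<open>P\<^sub>m\<close> is already known for \<open>m < n\<close>. The difference of \<open>P\<^sub>n\<close> and the explicit
  candidate has degree less than \<open>n\<close> and is orthogonal to these \<open>P\<^sub>m\<close>, so nondegeneracy, applied to
  the real and the imaginary part of each row, makes it zero.
\<close>
lemma monic_orthogonal_mpolys_unique:
  assumes P: "monic_orthogonal_mpolys N P" and "i \<le> N" "a \<le> N"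
  shows "P n $$ (i, a) = complex_poly (monic_spherical N n i a)"
  using assms(2,3)
proof (induction n arbitrary: i a rule: less_induct)
  case (less n)
  have carrier: "P m \<in> carrier_mat (N + 1) (N + 1)" for m
    using P by (simp add: monic_orthogonal_mpolys_def monic_mpoly_def)
  have lead: "coeff (P n $$ (i, b)) n = (if i = b then 1 else 0)" if "b \<le> N" for b
  proof -
    have "mpoly_coeff (P n) n = 1\<^sub>m (N + 1)"
      using P by (simp add: monic_orthogonal_mpolys_def monic_mpoly_def)
    from arg_cong[OF this, of "\<lambda>M. M $$ (i, b)"] show ?thesis
      using that less.prems carrier[of n] by (simp add: mpoly_coeff_def)
  qed
  have high: "coeff (P n $$ (i, b)) k = 0" if "b \<le> N" "n < k" for b k
  proof -
    have "mpoly_coeff (P n) k = 0\<^sub>m (N + 1) (N + 1)"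
      using P that by (simp add: monic_orthogonal_mpolys_def monic_mpoly_def)
    from arg_cong[OF this, of "\<lambda>M. M $$ (i, b)"] show ?thesis
      using that less.prems carrier[of n] by (simp add: mpoly_coeff_def)
  qed
  have orth: "row_pairing N (\<lambda>a. map_poly Re (P n $$ (i, a))) (spherical N m k) = 0"
    "row_pairing N (\<lambda>a. map_poly Im (P n $$ (i, a))) (spherical N m k) = 0" if "m < n" "k \<le> N" for m k
  proof -
    have "weight_pairing N (P n) (P m) $$ (i, k) = 0"
      using P that less.prems by (simp add: monic_orthogonal_mpolys_def)
    then have "row_pairing N (\<lambda>a. map_poly f (P n $$ (i, a))) (monic_spherical N m k) = 0"
      if "f = Re \<or> f = Im" for f
      using that weight_pairing_index[OF carrier carrier less.prems(1) \<open>k \<le> N\<close> less.IH[OF \<open>m < n\<close> \<open>k \<le> N\<close>], of n]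
      by (auto simp: complex_eq_iff)
    then have "row_pairing N (monic_spherical N m k) (\<lambda>a. map_poly f (P n $$ (i, a))) = 0"
      if "f = Re \<or> f = Im" for f
      using that row_pairing_commute by metis
    then have "row_pairing N (spherical N m k) (\<lambda>a. map_poly f (P n $$ (i, a))) = 0"
      if "f = Re \<or> f = Im" for f
      using that monic_factor_pos[OF \<open>k \<le> N\<close>, of m]
      by (auto simp: monic_spherical_def[abs_def] row_pairing_smult_left)
    then show "row_pairing N (\<lambda>a. map_poly Re (P n $$ (i, a))) (spherical N m k) = 0"
      "row_pairing N (\<lambda>a. map_poly Im (P n $$ (i, a))) (spherical N m k) = 0"
      by (simp_all add: row_pairing_commute[of N _ "spherical N m k"])
  qed
  have "map_poly Re (P n $$ (i, a)) - monic_spherical N n i a = 0"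
  proof (rule row_pairing_nondegenerate[of N n "\<lambda>a. map_poly Re (P n $$ (i, a)) - monic_spherical N n i a"])
    fix b k assume "b \<le> N" "n \<le> k"
    then show "coeff (map_poly Re (P n $$ (i, b)) - monic_spherical N n i b) k = 0"
      using less.prems lead[of b] high[of b k] monic_factor_pos[of i N n]
      by (cases "n = k") (auto simp add: coeff_map_poly monic_spherical_def coeff_spherical)
  next
    fix m k assume "m < n" "k \<le> N"
    then show "row_pairing N (\<lambda>a. map_poly Re (P n $$ (i, a)) - monic_spherical N n i a) (spherical N m k) = 0"
      unfolding row_pairing_diff_left monic_spherical_def row_pairing_smult_left
      using orth gram_upper[of m n i N k] less.prems by (simp add: gram_def)
  qed (use less.prems in simp)
  moreover have "map_poly Im (P n $$ (i, a)) = 0"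
  proof (rule row_pairing_nondegenerate[of N n "\<lambda>a. map_poly Im (P n $$ (i, a))"])
    fix b k assume "b \<le> N" "n \<le> k"
    then show "coeff (map_poly Im (P n $$ (i, b))) k = 0"
      using lead[of b] high[of b k] by (cases "n = k") (simp_all add: coeff_map_poly)
  qed (use less.prems orth in simp_all)
  ultimately have "Re (coeff (P n $$ (i, a)) k) = coeff (monic_spherical N n i a) k \<and> Im (coeff (P n $$ (i, a)) k) = 0" for k
    by (simp add: poly_eq_iff coeff_map_poly)
  then show ?case by (simp add: poly_eq_iff coeff_map_poly complex_eq_iff)
qed

text \<open>
  The ratio of neighbouring factors within one row turns the symmetric horizontal coefficients
  into those of \<open>X\<^sub>n\<close>.
\<close>
lemma monic_factor_Suc_index:
  assumes "i < N"
  shows "monic_factor N n (Suc i) * (lidx n i * (real N - real i)) =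
    monic_factor N n i * ((real i + 1) * (real n + real N - real i))"
proof (induction n)
  case 0
  then show ?case by (simp add: monic_factor_def algebra_simps)
next
  case (Suc n)
  let ?v = "vert_coef N (Suc n)" and ?d = "real n + real N - real i"
  have pos: "?d > 0" "lidx n i > 0" using assms by simp_all
  have "monic_factor N (Suc n) (Suc i) * (lidx (Suc n) i * (real N - real i)) =
      (monic_factor N n (Suc i) * (lidx n i * (real N - real i))) * ?v * lidx (Suc n) i
        / (2 * lidx (Suc n) i * ?d * lidx n i)"
    using pos by (simp add: monic_factor_def divide_simps)
  also have "\<dots> = monic_factor N (Suc n) i * ((real i + 1) * (real (Suc n) + real N - real i))"
    unfolding Suc using assms by (simp add: monic_factor_def divide_simps) (simp add: algebra_simps)
  finally show ?case .
qed

text \<open>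
  The asserted recurrence in the variable \<open>x = 1 - 2 u\<close>, in which the diagonal part of \<open>X\<^sub>n\<close>
  disappears. At the boundary labels some denominators may vanish; there the numerators are zero
  as well, in agreement with division by zero giving zero.
\<close>
lemma monic_spherical_recurrence:
  assumes "i \<le> N"
  shows "pCons 0 (monic_spherical N n i j) =
    monic_spherical N (Suc n) i j
    + Polynomial.smult ((real n)\<^sup>2 * (real N + real n + 1)\<^sup>2
        / (4 * (real n + real i) * (real n + real i + 1) * (real N + real n - real i) * (real N + real n - real i + 1)))
        (monic_spherical N (n - 1) i j)
    + Polynomial.smult ((real i)\<^sup>2 / (2 * (real n + real i) * (real n + real i + 1))) (monic_spherical N n (i - 1) j)
    + Polynomial.smult ((real N - real i)\<^sup>2 / (2 * (real N + real n - real i) * (real N + real n - real i + 1)))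
        (monic_spherical N n (Suc i) j)"
proof -
  let ?d = "2 * lidx n i * ridx N n i"
  have d: "?d > 0" and l: "lidx n i > 0" and r: "ridx N n i > 0" using assms by simp_all
  have up: "monic_factor N (Suc n) i = monic_factor N n i / ?d * vert_coef N (Suc n)"
    by (simp add: monic_factor_def)
  have down: "(real n)\<^sup>2 * (real N + real n + 1)\<^sup>2
        / (4 * (real n + real i) * (real n + real i + 1) * (real N + real n - real i) * (real N + real n - real i + 1))
      * monic_factor N (n - 1) i = monic_factor N n i / ?d * vert_coef N n"
  proof (cases n)
    case (Suc m)
    have "ridx N m i > 0" using assms by simp
    then show ?thesis using assms unfolding Suc
      by (simp add: monic_factor_def vert_coef_def divide_simps)
        (simp add: power2_eq_square algebra_simps)
  qed simp
  have left: "(real i)\<^sup>2 / (2 * (real n + real i) * (real n + real i + 1)) * monic_factor N n (i - 1) =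
      monic_factor N n i / ?d * horiz_coef N i"
  proof (cases i)
    case (Suc m)
    have pos: "real N - real m > 0" "real m + 1 > 0" "lidx n m > 0" "ridx N n i > 0" using Suc assms by simp_all
    have "monic_factor N n i * (lidx n m * (real N - real m)) = monic_factor N n m * ((real m + 1) * (real n + real N - real m))"
      using monic_factor_Suc_index[of m N n] Suc assms by simp
    then have g: "monic_factor N n m = monic_factor N n i * (lidx n m * (real N - real m)) / ((real m + 1) * (real n + real N - real m))"
      using pos by (simp add: eq_divide_eq)
    show ?thesis using pos unfolding Suc diff_Suc_1 g[unfolded Suc]
      by (simp add: horiz_coef_def divide_simps) (simp add: power2_eq_square algebra_simps)
  qed simp
  have right: "(real N - real i)\<^sup>2 / (2 * (real N + real n - real i) * (real N + real n - real i + 1)) * monic_factor N n (Suc i) =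
      monic_factor N n i / ?d * horiz_coef N (Suc i)"
  proof (cases "i = N")
    case False
    then have pos: "real N - real i > 0" "lidx n i > 0" "ridx N n i > 0" using assms by simp_all
    have "monic_factor N n (Suc i) * (lidx n i * (real N - real i)) = monic_factor N n i * ((real i + 1) * (real n + real N - real i))"
      using monic_factor_Suc_index[of i N n] False assms by simp
    then have g: "monic_factor N n (Suc i) = monic_factor N n i * ((real i + 1) * (real n + real N - real i)) / (lidx n i * (real N - real i))"
      using pos by (simp add: eq_divide_eq)
    show ?thesis using pos unfolding g
      by (simp add: horiz_coef_def divide_simps) (simp add: power2_eq_square algebra_simps)
  qed simp
  have "pCons 0 (monic_spherical N n i j) =
      Polynomial.smult (monic_factor N n i / ?d) (Polynomial.smult ?d (pCons 0 (spherical N n i j)))"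
  proof -
    have cancel: "a / b * b = a" if "b > 0" for a b :: real using that by simp
    show ?thesis unfolding smult_smult cancel[OF d] by (simp add: monic_spherical_def)
  qed
  then show ?thesis
    unfolding spherical_recurrence smult_add_right smult_smult monic_spherical_def up down left right
    by simp
qed

lemma sum_mat_unit:
  assumes "r \<le> N" "s \<le> N"
  shows "(\<Sum>i = 0..N. c i * mat_unit (int i) (int i + e) r s) = (if int s = int r + e then c r else 0)"
proof -
  have "c i * mat_unit (int i) (int i + e) r s = (if i = r then if int s = int r + e then c r else 0 else 0)" for i
    by (simp add: mat_unit_def)
  then show ?thesis using assms by simp
qed

lemma X_mat_index:
  assumes "r \<le> N" "s \<le> N"
  shows "X_mat N n $$ (r, s) =
    (if s = r then 1 / 2 else 0)
    - (if Suc s = r then of_nat r ^ 2 / (4 * (of_nat n + of_nat r) * (of_nat n + of_nat r + 1)) else 0)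
    - (if s = Suc r then (of_nat N - of_nat r) ^ 2
         / (4 * (of_nat N + of_nat n - of_nat r) * (of_nat N + of_nat n - of_nat r + 1)) else 0)"
proof -
  let ?a = "\<lambda>i. of_nat i ^ 2 / (4 * (of_nat n + of_nat i) * (of_nat n + of_nat i + 1)) :: complex"
  let ?b = "\<lambda>i. (of_nat N - of_nat i) ^ 2
         / (4 * (of_nat N + of_nat n - of_nat i) * (of_nat N + of_nat n - of_nat i + 1)) :: complex"
  have "X_mat N n $$ (r, s) = - ((\<Sum>i = 0..N. ?a i * mat_unit (int i) (int i + (- 1)) r s)
      - (\<Sum>i = 0..N. (1 / 2) * mat_unit (int i) (int i + 0) r s)
      + (\<Sum>i = 0..N. ?b i * mat_unit (int i) (int i + 1) r s))"
    using assms by (simp add: X_mat_def sum.distrib sum_subtractf)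
  then show ?thesis
    unfolding sum_mat_unit[OF assms] by auto
qed

lemma Y_mat_index:
  assumes "r \<le> N" "s \<le> N"
  shows "Y_mat N n $$ (r, s) = (if s = r then of_nat n ^ 2 * (of_nat N + of_nat n + 1) ^ 2
       / (16 * (of_nat n + of_nat r) * (of_nat n + of_nat r + 1)
          * (of_nat N + of_nat n - of_nat r) * (of_nat N + of_nat n - of_nat r + 1)) else 0)"
proof -
  let ?c = "\<lambda>i. of_nat n ^ 2 * (of_nat N + of_nat n + 1) ^ 2
       / (16 * (of_nat n + of_nat i) * (of_nat n + of_nat i + 1)
          * (of_nat N + of_nat n - of_nat i) * (of_nat N + of_nat n - of_nat i + 1)) :: complex"
  have "Y_mat N n $$ (r, s) = (\<Sum>i = 0..N. ?c i * mat_unit (int i) (int i + 0) r s)"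
    using assms by (simp add: Y_mat_def)
  then show ?thesis unfolding sum_mat_unit[OF assms] by simp
qed

text \<open>
  At \<open>r = 0\<close> and \<open>r = N\<close> the row of \<open>M\<close> outside the range is multiplied by zero.
\<close>
lemma X_mat_mult_index:
  assumes "r \<le> N" "a \<le> N" and M: "M \<in> carrier_mat (N + 1) (N + 1)"
  shows "(X_mat N n * M) $$ (r, a) = M $$ (r, a) / 2
    - of_nat r ^ 2 / (4 * (of_nat n + of_nat r) * (of_nat n + of_nat r + 1)) * M $$ (r - 1, a)
    - (of_nat N - of_nat r) ^ 2
         / (4 * (of_nat N + of_nat n - of_nat r) * (of_nat N + of_nat n - of_nat r + 1)) * M $$ (Suc r, a)"
    (is "_ = _ - ?l * _ - ?u * _")
proof -
  have X: "X_mat N n \<in> carrier_mat (N + 1) (N + 1)" by (simp add: X_mat_def)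
  have "(X_mat N n * M) $$ (r, a) = (\<Sum>s\<le>N. X_mat N n $$ (r, s) * M $$ (s, a))"
    using X M assms by (simp add: scalar_prod_def atLeast0LessThan lessThan_Suc_atMost)
  also have "\<dots> = (\<Sum>s\<le>N. (if s = r then M $$ (r, a) / 2 else 0)
      - (if Suc s = r then ?l * M $$ (r - 1, a) else 0)
      - (if s = Suc r then ?u * M $$ (Suc r, a) else 0))"
    by (rule sum.cong) (use assms in \<open>auto simp: X_mat_index left_diff_distrib\<close>)
  also have "\<dots> = M $$ (r, a) / 2 - (\<Sum>s\<le>N. if Suc s = r then ?l * M $$ (r - 1, a) else 0)
      - (\<Sum>s\<le>N. if s = Suc r then ?u * M $$ (Suc r, a) else 0)"
    using assms by (simp add: sum_subtractf)
  also have "(\<Sum>s\<le>N. if Suc s = r then ?l * M $$ (r - 1, a) else 0) = ?l * M $$ (r - 1, a)"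
    using assms by (cases r) simp_all
  also have "(\<Sum>s\<le>N. if s = Suc r then ?u * M $$ (Suc r, a) else 0) = ?u * M $$ (Suc r, a)"
    using assms by (cases "r = N") simp_all
  finally show ?thesis .
qed

lemma Y_mat_mult_index:
  assumes "r \<le> N" "a \<le> N" and M: "M \<in> carrier_mat (N + 1) (N + 1)"
  shows "(Y_mat N n * M) $$ (r, a) = of_nat n ^ 2 * (of_nat N + of_nat n + 1) ^ 2
       / (16 * (of_nat n + of_nat r) * (of_nat n + of_nat r + 1)
          * (of_nat N + of_nat n - of_nat r) * (of_nat N + of_nat n - of_nat r + 1)) * M $$ (r, a)"
    (is "_ = ?c * _")
proof -
  have Y: "Y_mat N n \<in> carrier_mat (N + 1) (N + 1)" by (simp add: Y_mat_def)
  have "(Y_mat N n * M) $$ (r, a) = (\<Sum>s\<le>N. Y_mat N n $$ (r, s) * M $$ (s, a))"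
    using Y M assms by (simp add: scalar_prod_def atLeast0LessThan lessThan_Suc_atMost)
  also have "\<dots> = (\<Sum>s\<le>N. if s = r then ?c * M $$ (r, a) else 0)"
    by (rule sum.cong) (use assms in \<open>auto simp: Y_mat_index\<close>)
  also have "\<dots> = ?c * M $$ (r, a)" using assms by simp
  finally show ?thesis .
qed

theorem theorem5p3:
  fixes N n :: nat and P :: "nat \<Rightarrow> complex poly mat" and R :: "nat \<Rightarrow> complex \<Rightarrow> complex mat"
    and u :: complex
  assumes "monic_orthogonal_mpolys N P"
  defines "R \<equiv> shifted_mpoly P"
  shows "u \<cdot>\<^sub>m R n u =
    R (n + 1) u + X_mat N n * R n u
    + Y_mat N n * (if n = 0 then 0\<^sub>m (N + 1) (N + 1) else R (n - 1) u)"
proof -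
  define f where "f = (\<lambda>n i a. poly (complex_poly (monic_spherical N n i a)) (1 - 2 * u))"
  define c where "c = (\<lambda>n. (- 1) ^ n / 2 ^ n :: complex)"
  have P: "P n \<in> carrier_mat (N + 1) (N + 1)" for n
    using assms(1) by (simp add: monic_orthogonal_mpolys_def monic_mpoly_def)
  have R: "R n u \<in> carrier_mat (N + 1) (N + 1)" for n
    using P[of n] by (simp add: R_def shifted_mpoly_def mpoly_eval_def)
  have R_index: "R n u $$ (i, a) = c n * f n i a" if "i \<le> N" "a \<le> N" for n i a
    using P[of n] that monic_orthogonal_mpolys_unique[OF assms(1) that, of n]
    by (simp add: R_def shifted_mpoly_def mpoly_eval_def c_def f_def)
  let ?Y = "Y_mat N n * (if n = 0 then 0\<^sub>m (N + 1) (N + 1) else R (n - 1) u)"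
  have Y: "(if n = 0 then 0\<^sub>m (N + 1) (N + 1) else R (n - 1) u) \<in> carrier_mat (N + 1) (N + 1)"
    using R by simp
  show ?thesis
  proof (rule eq_matI)
    fix i a
    assume "i < dim_row (R (n + 1) u + X_mat N n * R n u + ?Y)"
      and "a < dim_col (R (n + 1) u + X_mat N n * R n u + ?Y)"
    then have i: "i \<le> N" and a: "a \<le> N"
      using Y by (auto simp: Y_mat_def)
    let ?y = "of_nat n ^ 2 * (of_nat N + of_nat n + 1) ^ 2
       / (16 * (of_nat n + of_nat i) * (of_nat n + of_nat i + 1)
          * (of_nat N + of_nat n - of_nat i) * (of_nat N + of_nat n - of_nat i + 1)) :: complex"
    let ?l = "of_nat i ^ 2 / (4 * (of_nat n + of_nat i) * (of_nat n + of_nat i + 1)) :: complex"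
    let ?u = "(of_nat N - of_nat i) ^ 2
         / (4 * (of_nat N + of_nat n - of_nat i) * (of_nat N + of_nat n - of_nat i + 1)) :: complex"
    have y: "complex_of_real ((real n)\<^sup>2 * (real N + real n + 1)\<^sup>2
        / (4 * (real n + real i) * (real n + real i + 1) * (real N + real n - real i) * (real N + real n - real i + 1)))
        = 4 * ?y"
    proof -
      have "A / (4 * B * C * D * E) = 4 * (A / (16 * B * C * D * E))" for A B C D E :: complex
        by simp
      note quarter = this
      show ?thesis unfolding quarter[symmetric] by simp
    qed
    have l: "complex_of_real ((real i)\<^sup>2 / (2 * (real n + real i) * (real n + real i + 1))) = 2 * ?l"
      and u: "complex_of_real ((real N - real i)\<^sup>2
        / (2 * (real N + real n - real i) * (real N + real n - real i + 1))) = 2 * ?u"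
    proof -
      have "A / (2 * B * C) = 2 * (A / (4 * B * C))" for A B C :: complex by simp
      note halve = this
      show "complex_of_real ((real i)\<^sup>2 / (2 * (real n + real i) * (real n + real i + 1))) = 2 * ?l"
        "complex_of_real ((real N - real i)\<^sup>2
          / (2 * (real N + real n - real i) * (real N + real n - real i + 1))) = 2 * ?u"
        unfolding halve[symmetric] by simp_all
    qed
    \<comment> \<open>The recurrence at the point \<open>x = 1 - 2 u\<close>, with the coefficients of \<open>X\<^sub>n\<close> and \<open>Y\<^sub>n\<close>.\<close>
    have rec: "(1 - 2 * u) * f n i a = f (Suc n) i a + 4 * ?y * f (n - 1) i a
        + 2 * ?l * f n (i - 1) a + 2 * ?u * f n (Suc i) a"
      using arg_cong[OF monic_spherical_recurrence[OF i, of n a], of "\<lambda>p. poly (complex_poly p) (1 - 2 * u)"]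
      unfolding complex_poly_add complex_poly_smult complex_poly_pCons poly_add poly_smult poly_pCons y l u
      by (simp only: f_def of_real_0 add_0_left)
    have low: "c n * ?l * f n (i - 1) a = ?l * R n u $$ (i - 1, a)"
      using R_index[of "i - 1" a n] i a by simp
    have high: "c n * ?u * f n (Suc i) a = ?u * R n u $$ (Suc i, a)"
      using R_index[of "Suc i" a n] i a by (cases "i = N") simp_all
    have down: "- 2 * c n * ?y * f (n - 1) i a = ?Y $$ (i, a)"
    proof (cases n)
      case 0
      then show ?thesis unfolding Y_mat_mult_index[OF i a Y] by simp
    next
      case (Suc m)
      have "- 2 * c n = c m" by (simp add: Suc c_def)
      then have "- 2 * c n * ?y * f (n - 1) i a = ?y * (c m * f m i a)"
        unfolding Suc by (simp only: mult_ac diff_Suc_1)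
      then show ?thesis
        unfolding Y_mat_mult_index[OF i a Y] R_index[OF i a, symmetric] by (simp only: Suc) simp
    qed
    have "u * (c n * f n i a) = c n / 2 * f n i a - c n / 2 * ((1 - 2 * u) * f n i a)"
      by (simp add: field_simps)
    also have "\<dots> = c (Suc n) * f (Suc n) i a + (c n * f n i a / 2 - c n * ?l * f n (i - 1) a
        - c n * ?u * f n (Suc i) a) - 2 * c n * ?y * f (n - 1) i a"
      unfolding rec by (simp add: c_def algebra_simps)
    finally have "u * R n u $$ (i, a) = R (Suc n) u $$ (i, a) + (X_mat N n * R n u) $$ (i, a) + ?Y $$ (i, a)"
      unfolding low high X_mat_mult_index[OF i a R] R_index[OF i a] using down by simp
    then show "(u \<cdot>\<^sub>m R n u) $$ (i, a) = (R (n + 1) u + X_mat N n * R n u + ?Y) $$ (i, a)"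
      using i a R[of n] R[of "Suc n"] Y by (simp add: X_mat_def Y_mat_def)
  qed (use R[of n] Y in \<open>auto simp: Y_mat_def\<close>)
qed

end
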